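(* Let $S_1,S_2,T$ be $\mathrm{Cu}$-semigroups, and let $Z$ be the Cuntz semigroup of the Jiang–Su algebra. (a) Let $\varphi_1\colon S_1\to S_2$ and $\varphi_2\colon S_2\to T$ be generalized $\mathrm{Cu}$-morphisms. Assume that $\varphi_1$ is almost divisible and that $\varphi_2$ is almost unperforated. Then there exists a generalized $\mathrm{Cu}$-morphism $\beta\colon S_1\otimes Z\to T$ such that $\beta(x\otimes1)=\varphi_2\varphi_1(x)$ for every $x\in S_1$. (b) If, in addition, $\varphi_1$ and $\varphi_2$ are $\mathrm{Cu}$-morphisms, then there exists a $\mathrm{Cu}$-morphism $\beta\colon S_1\otimes Z\to T$ such that $\beta(x\otimes1)=\varphi_2\varphi_1(x)$ for every $x\in S_1$.
   Context: In an ordered set, $x\ll y$ means: for every increasing sequence $(z_n)$ with supremum $\geq y$ there is $n$ with $x\leq z_n$. A $\mathrm{Cu}$-semigroup is a positively ordered (commutative) monoid $S$ such that: (O1) increasing sequences have suprema; (O2) every element is the supremum of a $\ll$-increasing sequence; (O3) $x'\ll x$, $y'\ll y$ imply $x'+y'\ll x+y$; (O4) $\sup_n(x_n+y_n)=\sup_nx_n+\sup_ny_n$ for increasing sequences. A generalized $\mathrm{Cu}$-morphism is a monoid morphism between $\mathrm{Cu}$-semigroups preserving order and suprema of increasing sequences; a $\mathrm{Cu}$-morphism additionally preserves $\ll$. A generalized $\mathrm{Cu}$-morphism $\varphi\colon S\to T$ is almost unperforated if $\varphi(x)\leq\varphi(y)$ whenever $x,y\in S$ and $(m+1)x\leq my$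 for some $m\in\mathbb{N}$; it is almost divisible if for every $k\in\mathbb{N}$ and $x',x\in S$ with $x'\ll x$ there is $z\in T$ with $kz\leq\varphi(x)$ and $\varphi(x')\leq(k+1)z$. $Z=Z_c\cup Z_{\mathrm{soft}}$ with $Z_c=\{0,1,2,\dots\}$ (compact elements) and $Z_{\mathrm{soft}}=[0,\infty]$ (soft elements), $Z_c\cap Z_{\mathrm{soft}}=\{0\}$. Order and addition within each part are the usual ones; for $n\in Z_c$, $n\ge1$, and $t\in Z_{\mathrm{soft}}$, $t\neq0$: $n+t$ is the soft element $n+t$; $t\leq n$ in $Z$ iff $t\leq n$ as numbers; $n\leq t$ in $Z$ iff $n<t$ as numbers. The element $1$ in $x\otimes1$ is the compact element $1\in Z_c$ (the class of the unit of the Jiang–Su algebra). A generalized $\mathrm{Cu}$-bimorphism $f\colon S\times T\to R$ is a map that is a generalized $\mathrm{Cu}$-morphism in each variable; it is a $\mathrm{Cu}$-bimorphism if also $f(x',y')\ll f(x,y)$ whenever $x'\ll x$, $y'\ll y$. The tensor product $S\otimes T$ is the $\mathrm{Cu}$-semigroup with a $\mathrm{Cu}$-bimorphism $(x,y)\mapsto x\otimes y$ that is universal: every (generalized) $\mathrm{Cu}$-bimorphism $S\times T\to R$ factors uniquely through it via a (generalized) $\mathrm{Cu}$-morphism $S\otimes T\to R$. *)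

theory Defs
  imports "HOL-Algebra.Group" "HOL-Library.Extended_Nonnegative_Real"
begin

section \<open>Positively ordered monoids\<close>

text \<open>Carrier-based ordered monoids on top of the commutative monoids of \<open>HOL-Algebra\<close>, which
  are rewritten additively here: \<open>n \<cdot>\<^bsub>S\<^esub> x\<close> is the \<open>n\<close>-fold sum \<open>x + \<dots> + x\<close>.\<close>

record 'a pomonoid = "'a monoid" +
  leq :: "['a, 'a] \<Rightarrow> bool" (infix "\<preceq>\<index>" 50)

abbreviation cu_zero :: "('a, 'm) monoid_scheme \<Rightarrow> 'a" ("\<zero>\<index>")
  where "\<zero>\<^bsub>S\<^esub> \<equiv> one S"

abbreviation cu_add :: "('a, 'm) monoid_scheme \<Rightarrow> 'a \<Rightarrow> 'a \<Rightarrow> 'a" (infixl "\<oplus>\<index>" 65)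
  where "x \<oplus>\<^bsub>S\<^esub> y \<equiv> mult S x y"

abbreviation cu_multiple :: "('a, 'm) monoid_scheme \<Rightarrow> nat \<Rightarrow> 'a \<Rightarrow> 'a" ("_ \<cdot>\<index> _" [81, 81] 80)
  where "n \<cdot>\<^bsub>S\<^esub> x \<equiv> x [^]\<^bsub>S\<^esub> n"

locale positively_ordered_monoid = comm_monoid S for S :: "'a pomonoid" (structure) +
  assumes leq_refl: "reflp_on (carrier S) (leq S)"
    and leq_trans: "transp_on (carrier S) (leq S)"
    and leq_antisym: "antisymp_on (carrier S) (leq S)"
    and add_mono: "\<lbrakk>x \<in> carrier S; x' \<in> carrier S; y \<in> carrier S; y' \<in> carrier S;
                     x \<preceq> x'; y \<preceq> y'\<rbrakk> \<Longrightarrow> x \<oplus> y \<preceq> x' \<oplus> y'"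
    and zero_least: "x \<in> carrier S \<Longrightarrow> \<zero> \<preceq> x"


section \<open>Cu-semigroups\<close>

definition increasing_seq :: "'a pomonoid \<Rightarrow> (nat \<Rightarrow> 'a) \<Rightarrow> bool" where
  "increasing_seq S z \<longleftrightarrow> range z \<subseteq> carrier S \<and> monotone (\<le>) (leq S) z"

definition is_seq_sup :: "'a pomonoid \<Rightarrow> (nat \<Rightarrow> 'a) \<Rightarrow> 'a \<Rightarrow> bool" where
  "is_seq_sup S z s \<longleftrightarrow> s \<in> carrier S \<and> (\<forall>n. z n \<preceq>\<^bsub>S\<^esub> s) \<and>
     (\<forall>u\<in>carrier S. (\<forall>n. z n \<preceq>\<^bsub>S\<^esub> u) \<longrightarrow> s \<preceq>\<^bsub>S\<^esub> u)"

definition way_below :: "'a pomonoid \<Rightarrow> 'a \<Rightarrow> 'a \<Rightarrow> bool" where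
  "way_below S x y \<longleftrightarrow> x \<in> carrier S \<and> y \<in> carrier S \<and>
     (\<forall>z s. increasing_seq S z \<and> is_seq_sup S z s \<and> y \<preceq>\<^bsub>S\<^esub> s \<longrightarrow> (\<exists>n. x \<preceq>\<^bsub>S\<^esub> z n))"

locale cu_semigroup = positively_ordered_monoid S for S :: "'a pomonoid" (structure) +
  assumes O1: "increasing_seq S z \<Longrightarrow> \<exists>s. is_seq_sup S z s"
    and O2: "x \<in> carrier S \<Longrightarrow> \<exists>z. (\<forall>n. way_below S (z n) (z (Suc n))) \<and> is_seq_sup S z x"
    and O3: "\<lbrakk>way_below S x' x; way_below S y' y\<rbrakk> \<Longrightarrow> way_below S (x' \<oplus> y') (x \<oplus> y)"
    and O4: "\<lbrakk>increasing_seq S z; increasing_seq S w; is_seq_sup S z s; is_seq_sup S w t\<rbrakk>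
              \<Longrightarrow> is_seq_sup S (\<lambda>n. z n \<oplus> w n) (s \<oplus> t)"


section \<open>Morphisms\<close>

text \<open>Only the values of a map on the carrier of its domain matter.\<close>

definition gen_cu_morphism :: "'a pomonoid \<Rightarrow> 'b pomonoid \<Rightarrow> ('a \<Rightarrow> 'b) \<Rightarrow> bool" where
  "gen_cu_morphism S T \<phi> \<longleftrightarrow>
     \<phi> \<in> hom S T \<and> \<phi> \<zero>\<^bsub>S\<^esub> = \<zero>\<^bsub>T\<^esub> \<and>
     monotone_on (carrier S) (leq S) (leq T) \<phi> \<and>
     (\<forall>z s. increasing_seq S z \<and> is_seq_sup S z s \<longrightarrow> is_seq_sup T (\<phi> \<circ> z) (\<phi> s))"

definition cu_morphism :: "'a pomonoid \<Rightarrow> 'b pomonoid \<Rightarrow> ('a \<Rightarrow> 'b) \<Rightarrow> bool" where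
  "cu_morphism S T \<phi> \<longleftrightarrow> gen_cu_morphism S T \<phi> \<and>
     (\<forall>x y. way_below S x y \<longrightarrow> way_below T (\<phi> x) (\<phi> y))"

definition almost_unperforated :: "'a pomonoid \<Rightarrow> 'b pomonoid \<Rightarrow> ('a \<Rightarrow> 'b) \<Rightarrow> bool" where
  "almost_unperforated S T \<phi> \<longleftrightarrow>
     (\<forall>x\<in>carrier S. \<forall>y\<in>carrier S.
        (\<exists>m. (m + 1) \<cdot>\<^bsub>S\<^esub> x \<preceq>\<^bsub>S\<^esub> m \<cdot>\<^bsub>S\<^esub> y) \<longrightarrow> \<phi> x \<preceq>\<^bsub>T\<^esub> \<phi> y)"

definition almost_divisible :: "'a pomonoid \<Rightarrow> 'b pomonoid \<Rightarrow> ('a \<Rightarrow> 'b) \<Rightarrow> bool" where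
  "almost_divisible S T \<phi> \<longleftrightarrow>
     (\<forall>k x' x. way_below S x' x \<longrightarrow>
        (\<exists>z\<in>carrier T. k \<cdot>\<^bsub>T\<^esub> z \<preceq>\<^bsub>T\<^esub> \<phi> x \<and> \<phi> x' \<preceq>\<^bsub>T\<^esub> (k + 1) \<cdot>\<^bsub>T\<^esub> z))"


section \<open>Tensor products\<close>

definition gen_cu_bimorphism ::
  "'a pomonoid \<Rightarrow> 'b pomonoid \<Rightarrow> 'c pomonoid \<Rightarrow> ('a \<Rightarrow> 'b \<Rightarrow> 'c) \<Rightarrow> bool" where
  "gen_cu_bimorphism S T R f \<longleftrightarrow>
     (\<forall>x\<in>carrier S. gen_cu_morphism T R (\<lambda>y. f x y)) \<and>
     (\<forall>y\<in>carrier T. gen_cu_morphism S R (\<lambda>x. f x y))"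

definition cu_bimorphism ::
  "'a pomonoid \<Rightarrow> 'b pomonoid \<Rightarrow> 'c pomonoid \<Rightarrow> ('a \<Rightarrow> 'b \<Rightarrow> 'c) \<Rightarrow> bool" where
  "cu_bimorphism S T R f \<longleftrightarrow> gen_cu_bimorphism S T R f \<and>
     (\<forall>x' x y' y. way_below S x' x \<and> way_below T y' y \<longrightarrow> way_below R (f x' y') (f x y))"

text \<open>\<open>(P, t)\<close> is a tensor product of \<open>S\<close> and \<open>T\<close>, with \<open>t x y\<close> in the role of \<open>x \<otimes> y\<close>. HOL cannot
  quantify over types inside a formula, so the universal property is relative to a type \<open>'r\<close>: the
  test objects \<open>R\<close> are all Cu-semigroups whose carrier is a set of elements of \<open>'r\<close>. A tensor
  product in the usual sense satisfies this for every \<open>'r\<close>. Factorizations are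
  unique as maps on the carrier of \<open>P\<close>, hence the restriction to extensional functions.\<close>

definition is_cu_tensor ::
  "'r itself \<Rightarrow> 'a pomonoid \<Rightarrow> 'b pomonoid \<Rightarrow> 'p pomonoid \<Rightarrow> ('a \<Rightarrow> 'b \<Rightarrow> 'p) \<Rightarrow> bool" where
  "is_cu_tensor _ S T P t \<longleftrightarrow>
     cu_semigroup P \<and> cu_bimorphism S T P t \<and>
     (\<forall>(R :: 'r pomonoid) f. cu_semigroup R \<and> gen_cu_bimorphism S T R f \<longrightarrow>
        (\<exists>!g. g \<in> extensional (carrier P) \<and> gen_cu_morphism P R g \<and>
              (\<forall>x\<in>carrier S. \<forall>y\<in>carrier T. g (t x y) = f x y))) \<and>
     (\<forall>(R :: 'r pomonoid) f. cu_semigroup R \<and> cu_bimorphism S T R f \<longrightarrow>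
        (\<exists>!g. g \<in> extensional (carrier P) \<and> cu_morphism P R g \<and>
              (\<forall>x\<in>carrier S. \<forall>y\<in>carrier T. g (t x y) = f x y)))"


section \<open>The Cuntz semigroup of the Jiang--Su algebra\<close>

text \<open>The compact and the soft zero are identified by keeping only \<open>Compact 0\<close> in the carrier.\<close>

datatype jiang_su = Compact nat | Soft ennreal

fun jiang_su_add :: "jiang_su \<Rightarrow> jiang_su \<Rightarrow> jiang_su" where
  "jiang_su_add (Compact m) (Compact n) = Compact (m + n)"
| "jiang_su_add (Compact n) (Soft t) = Soft (of_nat n + t)"
| "jiang_su_add (Soft t) (Compact n) = Soft (t + of_nat n)"
| "jiang_su_add (Soft s) (Soft t) = Soft (s + t)"

fun jiang_su_leq :: "jiang_su \<Rightarrow> jiang_su \<Rightarrow> bool" where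
  "jiang_su_leq (Compact m) (Compact n) \<longleftrightarrow> m \<le> n"
| "jiang_su_leq (Compact n) (Soft t) \<longleftrightarrow> of_nat n < t"
| "jiang_su_leq (Soft t) (Compact n) \<longleftrightarrow> t \<le> of_nat n"
| "jiang_su_leq (Soft s) (Soft t) \<longleftrightarrow> s \<le> t"

definition Cu_jiang_su :: "jiang_su pomonoid" where
  "Cu_jiang_su = \<lparr>carrier = range Compact \<union> Soft ` {t. t \<noteq> 0},
     mult = jiang_su_add, one = Compact 0, leq = jiang_su_leq\<rparr>"

end

theory Submission
  imports Defs
begin

text \<open>The map \<open>\<beta>\<close> is obtained from the universal property of \<open>S\<^sub>1 \<otimes> Z\<close>, so it suffices to find a
  (generalized) Cu-bimorphism \<open>S\<^sub>1 \<times> Z \<rightarrow> T\<close> that sends \<open>(x, 1)\<close> to \<open>\<phi>\<^sub>2 (\<phi>\<^sub>1 x)\<close>. On compact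
  elements it is forced: \<open>(x, n)\<close> goes to \<open>n \<phi>\<^sub>2 (\<phi>\<^sub>1 x)\<close>. A soft element \<open>t\<close> has to act as
  multiplication by the real number \<open>t\<close>, which is defined by approximation from below: \<open>(x, t)\<close>
  goes to the supremum of the values \<open>\<phi>\<^sub>2 a\<close>, where \<open>a \<in> S\<^sub>2\<close> satisfies \<open>q a \<le> p \<phi>\<^sub>1 x\<close> for some
  fraction \<open>p/q < t\<close>.

  The two hypotheses are what makes this supremum exist and behave well. Let \<open>x' \<lless> x\<close>. Almost
  divisibility gives \<open>z \<in> S\<^sub>2\<close> with \<open>k z \<le> \<phi>\<^sub>1 x\<close> and \<open>\<phi>\<^sub>1 x' \<le> (k + 1) z\<close>. If \<open>m/k < t\<close>, then
  \<open>a = m z\<close> is one of the elements above. Conversely, if \<open>q b \<le> p \<phi>\<^sub>1 x'\<close> with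
  \<open>p/q < m/(k + 1)\<close>, then \<open>q m b \<le> p (k + 1) (m z)\<close> with \<open>p (k + 1) < q m\<close>, so that
  \<open>\<phi>\<^sub>2 b \<le> \<phi>\<^sub>2 (m z)\<close> by almost unperforation (\<open>\<phi>\<^sub>2_leq_multipleI\<close>). Since both \<open>m/k\<close> and
  \<open>m/(k + 1)\<close> can be placed between a given \<open>r < t\<close> and \<open>t\<close> (\<open>eventually_fraction_between\<close>), the
  values \<open>\<phi>\<^sub>2 (m z)\<close> can be arranged in an increasing sequence that is cofinal
  (\<open>fraction_below_cofinal_seq\<close>). The passage from \<open>x\<close> to all \<open>x' \<lless> x\<close> is harmless because
  \<open>\<phi>\<^sub>1\<close>, \<open>\<phi>\<^sub>2\<close> and multiples preserve suprema of increasing sequences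
  (\<open>\<phi>\<^sub>2_leq_by_approximation\<close>).

  The same comparison proves subadditivity in each variable: below \<open>x + y\<close> take \<open>k\<close>-th parts of
  both summands, and below \<open>s + t\<close> split the fraction in two with a common denominator.
  Superadditivity and monotonicity amount to arithmetic with fractions. Finally, if \<open>\<phi>\<^sub>1\<close> and
  \<open>\<phi>\<^sub>2\<close> preserve \<open>\<lless>\<close> and \<open>x' \<lless> x\<close>, \<open>r < t\<close>, then \<open>z\<close> can be replaced in the comparison by some
  \<open>z' \<lless> z\<close>, so that \<open>\<phi>\<^sub>2 (m z') \<lless> \<phi>\<^sub>2 (m z)\<close> separates the values at \<open>(x', r)\<close> and \<open>(x, t)\<close>
  (\<open>pairing_way_below_Soft\<close>).\<close>

section \<open>Multiples and the way-below relation\<close>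

context positively_ordered_monoid
begin

lemma leq_reflI [simp]: "x \<in> carrier S \<Longrightarrow> x \<preceq> x"
  using leq_refl by (auto simp: reflp_on_def)

lemma leq_transD:
  "\<lbrakk>x \<preceq> y; y \<preceq> z; x \<in> carrier S; y \<in> carrier S; z \<in> carrier S\<rbrakk> \<Longrightarrow> x \<preceq> z"
  using leq_trans unfolding transp_on_def by blast

lemma leq_antisymD:
  "\<lbrakk>x \<preceq> y; y \<preceq> x; x \<in> carrier S; y \<in> carrier S\<rbrakk> \<Longrightarrow> x = y"
  using leq_antisym by (auto simp: antisymp_on_def)

lemma multiple_mono:
  "\<lbrakk>x \<preceq> y; x \<in> carrier S; y \<in> carrier S\<rbrakk> \<Longrightarrow> n \<cdot>\<^bsub>S\<^esub> x \<preceq> n \<cdot>\<^bsub>S\<^esub> y"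
  by (induction n) (auto intro: add_mono)

lemma multiple_mono_nat:
  assumes "m \<le> n" and x: "x \<in> carrier S"
  shows "m \<cdot>\<^bsub>S\<^esub> x \<preceq> n \<cdot>\<^bsub>S\<^esub> x"
proof -
  obtain k where n: "n = m + k" using assms(1) le_Suc_ex by blast
  have "m \<cdot>\<^bsub>S\<^esub> x \<oplus> \<zero> \<preceq> m \<cdot>\<^bsub>S\<^esub> x \<oplus> k \<cdot>\<^bsub>S\<^esub> x"
    using x by (intro add_mono) (auto intro: zero_least)
  then show ?thesis using x by (simp add: n nat_pow_mult)
qed

lemma multiple_add:
  "\<lbrakk>x \<in> carrier S; y \<in> carrier S\<rbrakk> \<Longrightarrow> n \<cdot>\<^bsub>S\<^esub> (x \<oplus> y) = n \<cdot>\<^bsub>S\<^esub> x \<oplus> n \<cdot>\<^bsub>S\<^esub> y"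
  by (simp add: pow_mult_distrib m_comm)

lemma increasing_seq_carrier [simp]: "increasing_seq S z \<Longrightarrow> z n \<in> carrier S"
  by (auto simp: increasing_seq_def)

lemma increasing_seq_le: "\<lbrakk>increasing_seq S z; m \<le> n\<rbrakk> \<Longrightarrow> z m \<preceq> z n"
  by (auto simp: increasing_seq_def monotone_on_def)

lemma increasing_seq_SucI:
  assumes "\<And>n. z n \<in> carrier S" and "\<And>n. z n \<preceq> z (Suc n)"
  shows "increasing_seq S z"
proof -
  have "z m \<preceq> z n" if "m \<le> n" for m n
    using that
  proof (induction rule: dec_induct)
    case base
    show ?case using assms(1) by simp
  next
    case (step n)
    then show ?case using assms(1) by (intro leq_transD[OF step.IH assms(2)])
  qed
  then show ?thesis
    using assms(1) unfolding increasing_seq_def monotone_on_def by blast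
qed

lemma increasing_seq_add:
  "\<lbrakk>increasing_seq S z; increasing_seq S w\<rbrakk> \<Longrightarrow> increasing_seq S (\<lambda>n. z n \<oplus> w n)"
  by (rule increasing_seq_SucI) (simp_all add: add_mono increasing_seq_le)

lemma is_seq_sup_carrier: "is_seq_sup S z s \<Longrightarrow> s \<in> carrier S"
  by (simp add: is_seq_sup_def)

lemma is_seq_sup_upper: "is_seq_sup S z s \<Longrightarrow> z n \<preceq> s"
  by (simp add: is_seq_sup_def)

lemma is_seq_sup_least:
  "\<lbrakk>is_seq_sup S z s; u \<in> carrier S; \<And>n. z n \<preceq> u\<rbrakk> \<Longrightarrow> s \<preceq> u"
  by (simp add: is_seq_sup_def)

lemma way_below_carrier:
  assumes "way_below S x y"
  shows "x \<in> carrier S" and "y \<in> carrier S"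
  using assms by (auto simp: way_below_def)

lemma way_belowD:
  "\<lbrakk>way_below S x y; increasing_seq S z; is_seq_sup S z s; y \<preceq> s\<rbrakk> \<Longrightarrow> \<exists>n. x \<preceq> z n"
  by (auto simp: way_below_def)

lemma way_below_imp_leq:
  assumes "way_below S x y"
  shows "x \<preceq> y"
proof -
  have "increasing_seq S (\<lambda>_. y)" "is_seq_sup S (\<lambda>_. y) y"
    using way_below_carrier[OF assms]
    by (auto simp: increasing_seq_def monotone_on_def is_seq_sup_def)
  then show ?thesis
    using way_belowD[OF assms, of "\<lambda>_. y" y] way_below_carrier[OF assms] by auto
qed

lemma way_below_mono:
  assumes "x \<preceq> x'" and "way_below S x' y'" and "y' \<preceq> y" and "x \<in> carrier S" and "y \<in> carrier S"
  shows "way_below S x y"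
  unfolding way_below_def
proof (intro conjI allI impI)
  fix z s assume z: "increasing_seq S z \<and> is_seq_sup S z s \<and> y \<preceq> s"
  note carr = way_below_carrier[OF assms(2)]
  have "y' \<preceq> s"
    using z assms(5) carr is_seq_sup_carrier by (intro leq_transD[OF assms(3)]) auto
  then obtain n where "x' \<preceq> z n" using way_belowD[OF assms(2)] z by blast
  then show "\<exists>n. x \<preceq> z n"
    using leq_transD[OF assms(1) _ assms(4) carr(1)] z increasing_seq_carrier by blast
qed (use assms in auto)

lemma way_below_zero: "way_below S \<zero> \<zero>"
  by (auto simp: way_below_def increasing_seq_def intro!: zero_least)

end

context cu_semigroup
begin

lemma way_below_multiple: "way_below S x y \<Longrightarrow> way_below S (n \<cdot>\<^bsub>S\<^esub> x) (n \<cdot>\<^bsub>S\<^esub> y)"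
  by (induction n) (auto intro: O3 way_below_zero)

lemma increasing_seq_multiple:
  "increasing_seq S z \<Longrightarrow> increasing_seq S (\<lambda>j. n \<cdot>\<^bsub>S\<^esub> z j)"
  by (rule increasing_seq_SucI) (simp_all add: multiple_mono increasing_seq_le)

lemma is_seq_sup_multiple:
  assumes "increasing_seq S z" and "is_seq_sup S z s"
  shows "is_seq_sup S (\<lambda>j. n \<cdot>\<^bsub>S\<^esub> z j) (n \<cdot>\<^bsub>S\<^esub> s)"
proof (induction n)
  case 0
  show ?case by (auto simp: is_seq_sup_def)
next
  case (Suc n)
  then show ?case using O4[OF increasing_seq_multiple[OF assms(1)] assms(1) Suc.IH assms(2)] by simp
qed

lemma way_below_approximation:
  assumes "x \<in> carrier S"
  obtains z where "increasing_seq S z" "is_seq_sup S z x"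
    "\<And>n. way_below S (z n) (z (Suc n))" "\<And>n. way_below S (z n) x"
proof -
  obtain z where z: "\<forall>n. way_below S (z n) (z (Suc n))" "is_seq_sup S z x"
    using O2[OF assms] by blast
  have inc: "increasing_seq S z"
    by (rule increasing_seq_SucI) (use z(1) way_below_carrier(1) way_below_imp_leq in blast)+
  moreover have "way_below S (z n) x" for n
    using way_below_mono[OF _ z(1)[rule_format, of n]] z inc is_seq_sup_upper assms by simp
  ultimately show thesis using that z by blast
qed

lemma way_below_interpolation:
  assumes "way_below S x y"
  obtains w where "way_below S x w" "way_below S w y"
proof -
  note carr = way_below_carrier[OF assms]
  obtain z where z: "increasing_seq S z" "is_seq_sup S z y"
    "\<And>n. way_below S (z n) (z (Suc n))" "\<And>n. way_below S (z n) y"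
    using way_below_approximation[OF carr(2)] by blast
  obtain n where "x \<preceq> z n" using way_belowD[OF assms z(1,2)] carr by auto
  then have "way_below S x (z (Suc n))"
    using way_below_mono[OF _ z(3)[of n]] carr z(1) by simp
  then show thesis using that z(4) by blast
qed

end


section \<open>Generalized Cu-morphisms\<close>

lemma increasing_seq_comp:
  assumes "increasing_seq S z" and "f \<in> carrier S \<rightarrow> carrier T"
    and "monotone_on (carrier S) (leq S) (leq T) f"
  shows "increasing_seq T (f \<circ> z)"
  using assms by (auto simp: increasing_seq_def monotone_on_def image_subset_iff Pi_iff)

lemma gen_cu_morphismD:
  assumes "gen_cu_morphism S T f"
  shows "x \<in> carrier S \<Longrightarrow> f x \<in> carrier T"
    and "\<lbrakk>x \<in> carrier S; y \<in> carrier S\<rbrakk> \<Longrightarrow> f (x \<oplus>\<^bsub>S\<^esub> y) = f x \<oplus>\<^bsub>T\<^esub> f y"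
    and "f \<zero>\<^bsub>S\<^esub> = \<zero>\<^bsub>T\<^esub>"
    and "\<lbrakk>x \<in> carrier S; y \<in> carrier S; x \<preceq>\<^bsub>S\<^esub> y\<rbrakk> \<Longrightarrow> f x \<preceq>\<^bsub>T\<^esub> f y"
    and "\<lbrakk>increasing_seq S z; is_seq_sup S z s\<rbrakk> \<Longrightarrow> is_seq_sup T (\<lambda>n. f (z n)) (f s)"
    and "increasing_seq S z \<Longrightarrow> increasing_seq T (\<lambda>n. f (z n))"
  using assms increasing_seq_comp[of S z f T]
  by (auto simp: gen_cu_morphism_def hom_def monotone_on_def comp_def)

lemma gen_cu_morphism_multiple:
  assumes "cu_semigroup S" and "gen_cu_morphism S T f" and "x \<in> carrier S"
  shows "f (n \<cdot>\<^bsub>S\<^esub> x) = n \<cdot>\<^bsub>T\<^esub> f x"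
proof -
  interpret S: cu_semigroup S by fact
  show ?thesis
    using assms(3) by (induction n) (simp_all add: gen_cu_morphismD[OF assms(2)])
qed

text \<open>Given monotonicity, only one half of the preservation of suprema needs a proof: the image of
  the supremum lies below every upper bound of the images.\<close>

lemma gen_cu_morphismI:
  assumes "\<And>x. x \<in> carrier S \<Longrightarrow> f x \<in> carrier T"
    and "\<And>x y. \<lbrakk>x \<in> carrier S; y \<in> carrier S\<rbrakk> \<Longrightarrow> f (x \<oplus>\<^bsub>S\<^esub> y) = f x \<oplus>\<^bsub>T\<^esub> f y"
    and "f \<zero>\<^bsub>S\<^esub> = \<zero>\<^bsub>T\<^esub>"
    and "\<And>x y. \<lbrakk>x \<in> carrier S; y \<in> carrier S; x \<preceq>\<^bsub>S\<^esub> y\<rbrakk> \<Longrightarrow> f x \<preceq>\<^bsub>T\<^esub> f y"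
    and "\<And>z s u. \<lbrakk>increasing_seq S z; is_seq_sup S z s; u \<in> carrier T; \<And>n. f (z n) \<preceq>\<^bsub>T\<^esub> u\<rbrakk>
           \<Longrightarrow> f s \<preceq>\<^bsub>T\<^esub> u"
  shows "gen_cu_morphism S T f"
  unfolding gen_cu_morphism_def
proof (intro conjI allI impI)
  show "f \<in> hom S T" using assms(1,2) by (auto simp: hom_def)
  show "f \<zero>\<^bsub>S\<^esub> = \<zero>\<^bsub>T\<^esub>" by fact
  show "monotone_on (carrier S) (leq S) (leq T) f" using assms(4) by (auto simp: monotone_on_def)
  fix z s assume z: "increasing_seq S z \<and> is_seq_sup S z s"
  then have "s \<in> carrier S" "\<And>n. z n \<in> carrier S" "\<And>n. z n \<preceq>\<^bsub>S\<^esub> s"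
    by (auto simp: increasing_seq_def is_seq_sup_def)
  then show "is_seq_sup T (f \<circ> z) (f s)"
    unfolding is_seq_sup_def[of T] comp_def using assms(1,4) assms(5)[OF conjunct1[OF z] conjunct2[OF z]]
    by blast
qed


section \<open>Fractions below an extended real\<close>

text \<open>A real \<open>r\<close> below \<open>t\<close> lies below some \<open>m/(k+1)\<close> with \<open>m/k < t\<close>; since almost divisibility
  yields \<open>k\<close>-th parts only up to the discrepancy between \<open>k\<close> and \<open>k + 1\<close>, this is what makes
  multiples of such parts approximate a real multiple. It is stated for all large \<open>k\<close>, so that
  two values can be approximated with the same denominator.\<close>

lemma eventually_fraction_between:
  fixes r :: real and t :: ennreal
  assumes "0 \<le> r" and "ennreal r < t"
  shows "\<exists>K. \<forall>k\<ge>K. 0 < k \<and>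
    (\<exists>m. ennreal (real m / real k) < t \<and> r < real m / real (k + 1))"
proof -
  obtain c where c: "ennreal r < ennreal c" "ennreal c < t"
  proof -
    obtain d where d: "ennreal r < d" "d < t" using dense[OF assms(2)] by blast
    then show thesis using that by (cases d) (auto simp: top_unique)
  qed
  then have rc: "r < c" using assms(1) by (simp add: ennreal_less_iff)
  \<comment> \<open>Once \<open>k\<close> exceeds \<open>(r + 1) / (c - r)\<close>, the numbers \<open>r (k + 1)\<close> and \<open>c k\<close> differ by more than
    \<open>1\<close>, so an integer \<open>m\<close> fits between them.\<close>
  define K where "K = nat \<lceil>(r + 1) / (c - r)\<rceil> + 1"
  show ?thesis
  proof (rule exI[of _ K], intro allI impI conjI)
    fix k assume k: "K \<le> k"
    then show "0 < k" by (simp add: K_def)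
    have "(r + 1) / (c - r) < real k" using k unfolding K_def by linarith
    then have kc: "r * real (k + 1) + 1 < c * real k"
      using rc by (simp add: field_simps)
    define m where "m = nat \<lfloor>r * real (k + 1)\<rfloor> + 1"
    have nn: "0 \<le> r * real (k + 1)" using assms(1) by (simp add: mult_nonneg_nonneg)
    have m: "r * real (k + 1) < real m" "real m \<le> r * real (k + 1) + 1"
      using nn unfolding m_def by linarith+
    have "real m / real k < c" using m kc \<open>0 < k\<close> by (simp add: divide_less_eq)
    then have "ennreal (real m / real k) < t"
      using c(2) by (meson ennreal_leI less_imp_le order.strict_trans1)
    moreover have "r < real m / real (k + 1)" using m by (simp add: field_simps)
    ultimately show "\<exists>m. ennreal (real m / real k) < t \<and> r < real m / real (k + 1)" by blast
  qed
qed

lemma fraction_between: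
  fixes r :: real and t :: ennreal
  assumes "0 \<le> r" and "ennreal r < t"
  obtains k m where "0 < k" "ennreal (real m / real k) < t" "r < real m / real (k + 1)"
  using eventually_fraction_between[OF assms] by blast

text \<open>Both \<open>s\<close> and \<open>t\<close> have to be nonzero, as no nonnegative \<open>r\<^sub>1\<close> lies strictly below \<open>0\<close>.\<close>

lemma less_add_split:
  fixes r :: real and s t :: ennreal
  assumes r: "0 \<le> r" "ennreal r < s + t" and "s \<noteq> 0" and "t \<noteq> 0"
  obtains r\<^sub>1 r\<^sub>2 where "0 \<le> r\<^sub>1" "0 \<le> r\<^sub>2" "ennreal r\<^sub>1 < s" "ennreal r\<^sub>2 < t" "r < r\<^sub>1 + r\<^sub>2"
proof (cases s)
  case top
  then show thesis
    using that[of "r + 1" 0] assms by (auto simp: zero_less_iff_neq_zero)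
next
  case (real a)
  note s = this
  then have "0 < a" using \<open>s \<noteq> 0\<close> by (cases "a = 0") auto
  show thesis
  proof (cases t)
    case top
    then show thesis
      using that[of 0 "r + 1"] assms by (auto simp: zero_less_iff_neq_zero)
  next
    case (real b)
    then have "0 < b" using \<open>t \<noteq> 0\<close> by (cases "b = 0") auto
    have "r < a + b" using r s real by (simp add: ennreal_plus[symmetric] ennreal_less_iff del: ennreal_plus)
    define e where "e = (a + b - r) / 3"
    have "0 < e" using \<open>r < a + b\<close> by (simp add: e_def)
    show thesis
    proof (rule that[of "max 0 (a - e)" "max 0 (b - e)"])
      show "r < max 0 (a - e) + max 0 (b - e)"
        using \<open>0 < e\<close> unfolding e_def by (simp add: max_def field_simps)
    qed (use s real \<open>0 < e\<close> \<open>0 < a\<close> \<open>0 < b\<close> in \<open>auto simp: ennreal_less_iff\<close>)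
  qed
qed

lemma ennreal_add_less:
  fixes s t :: ennreal
  assumes "ennreal r \<le> s" and "ennreal r' \<le> t" and "ennreal r < s \<or> ennreal r' < t"
  shows "ennreal r + ennreal r' < s + t"
  using assms(3)
proof
  assume "ennreal r < s"
  then have "ennreal r' + ennreal r < ennreal r' + s" by (simp add: ennreal_add_left_cancel_less)
  also have "\<dots> \<le> t + s" using assms(2) by (rule add_right_mono)
  finally show ?thesis by (simp add: add.commute)
next
  assume "ennreal r' < t"
  then have "ennreal r + ennreal r' < ennreal r + t" by (simp add: ennreal_add_left_cancel_less)
  also have "\<dots> \<le> s + t" using assms(1) by (rule add_right_mono)
  finally show ?thesis .
qed

text \<open>The terms are positive, so that each \<open>r n\<close> is again a soft element of \<open>Z\<close>.\<close>

lemma strict_approximation_from_below: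
  fixes t :: ennreal
  assumes "t \<noteq> 0"
  obtains r :: "nat \<Rightarrow> real" where "\<And>n. 0 < r n" "\<And>n. r n < r (Suc n)" "\<And>n. ennreal (r n) < t"
    "\<And>c. \<lbrakk>0 \<le> c; ennreal c < t\<rbrakk> \<Longrightarrow> \<exists>n. c < r n"
proof (cases t)
  case top
  show thesis
  proof (rule that[of "\<lambda>n. real n + 1"])
    fix c :: real
    show "\<exists>n. c < real n + 1" using reals_Archimedean2[of c] by (meson less_add_one less_trans)
  qed (use top in auto)
next
  case (real b)
  then have "0 < b" using assms by (cases "b = 0") auto
  have tends: "(\<lambda>n. b * (1 - 1 / real (n + 2))) \<longlonglongrightarrow> b * (1 - 0)"
    by (intro tendsto_intros LIMSEQ_ignore_initial_segment[OF lim_1_over_n])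
  show thesis
  proof (rule that[of "\<lambda>n. b * (1 - 1 / real (n + 2))"])
    fix c :: real assume "0 \<le> c" "ennreal c < t"
    then have "c < b" using real by (simp add: ennreal_less_iff)
    then have "eventually (\<lambda>n. c < b * (1 - 1 / real (n + 2))) sequentially"
      using order_tendstoD(1)[OF tends, of c] by simp
    then show "\<exists>n. c < b * (1 - 1 / real (n + 2))"
      by (auto simp: eventually_sequentially)
  next
    fix n
    show "0 < b * (1 - 1 / real (n + 2))" using \<open>0 < b\<close> by simp
    then show "ennreal (b * (1 - 1 / real (n + 2))) < t"
      using real \<open>0 < b\<close> by (simp add: ennreal_less_iff field_simps)
    show "b * (1 - 1 / real (n + 2)) < b * (1 - 1 / real (Suc n + 2))"
      using \<open>0 < b\<close> by (simp add: field_simps)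
  qed
qed


section \<open>Real multiples\<close>

text \<open>The setting of the theorem, without the tensor product.\<close>

locale divisible_unperforated_pair =
  S\<^sub>1: cu_semigroup S\<^sub>1 + S\<^sub>2: cu_semigroup S\<^sub>2 + T: cu_semigroup T
  for S\<^sub>1 :: "'a pomonoid" and S\<^sub>2 :: "'b pomonoid" and T :: "'t pomonoid" +
  fixes \<phi>\<^sub>1 :: "'a \<Rightarrow> 'b" and \<phi>\<^sub>2 :: "'b \<Rightarrow> 't"
  assumes gen\<^sub>1: "gen_cu_morphism S\<^sub>1 S\<^sub>2 \<phi>\<^sub>1" and gen\<^sub>2: "gen_cu_morphism S\<^sub>2 T \<phi>\<^sub>2"
    and divisible: "almost_divisible S\<^sub>1 S\<^sub>2 \<phi>\<^sub>1" and unperforated: "almost_unperforated S\<^sub>2 T \<phi>\<^sub>2"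
begin

lemmas \<phi>\<^sub>1_closed [simp] = gen_cu_morphismD(1)[OF gen\<^sub>1]
lemmas \<phi>\<^sub>2_closed [simp] = gen_cu_morphismD(1)[OF gen\<^sub>2]
lemmas \<phi>\<^sub>1_add = gen_cu_morphismD(2)[OF gen\<^sub>1]
lemmas \<phi>\<^sub>2_add = gen_cu_morphismD(2)[OF gen\<^sub>2]
lemmas \<phi>\<^sub>1_zero [simp] = gen_cu_morphismD(3)[OF gen\<^sub>1]
lemmas \<phi>\<^sub>2_zero [simp] = gen_cu_morphismD(3)[OF gen\<^sub>2]
lemmas \<phi>\<^sub>1_mono = gen_cu_morphismD(4)[OF gen\<^sub>1]
lemmas \<phi>\<^sub>2_mono = gen_cu_morphismD(4)[OF gen\<^sub>2]
lemmas \<phi>\<^sub>2_multiple = gen_cu_morphism_multiple[OF S\<^sub>2.cu_semigroup_axioms gen\<^sub>2]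

text \<open>Almost unperforation for an arbitrary pair of coefficients \<open>k < l\<close>.\<close>

lemma \<phi>\<^sub>2_leqI:
  assumes "l \<cdot>\<^bsub>S\<^sub>2\<^esub> a \<preceq>\<^bsub>S\<^sub>2\<^esub> k \<cdot>\<^bsub>S\<^sub>2\<^esub> b" and "k < l" and ab: "a \<in> carrier S\<^sub>2" "b \<in> carrier S\<^sub>2"
  shows "\<phi>\<^sub>2 a \<preceq>\<^bsub>T\<^esub> \<phi>\<^sub>2 b"
proof -
  have "(k + 1) \<cdot>\<^bsub>S\<^sub>2\<^esub> a \<preceq>\<^bsub>S\<^sub>2\<^esub> l \<cdot>\<^bsub>S\<^sub>2\<^esub> a"
    using assms(2) ab by (intro S\<^sub>2.multiple_mono_nat) auto
  then have "(k + 1) \<cdot>\<^bsub>S\<^sub>2\<^esub> a \<preceq>\<^bsub>S\<^sub>2\<^esub> k \<cdot>\<^bsub>S\<^sub>2\<^esub> b"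
    by (rule S\<^sub>2.leq_transD) (use assms in auto)
  then show ?thesis
    using unperforated ab unfolding almost_unperforated_def by blast
qed

text \<open>The comparison at the heart of the construction, used with \<open>w = \<phi>\<^sub>1 x'\<close> for some \<open>x' \<lless> x\<close>
  and with \<open>z\<close> an almost \<open>k\<close>-th part of \<open>\<phi>\<^sub>1 x\<close>, or with sums of such elements.\<close>

lemma \<phi>\<^sub>2_leq_multipleI:
  assumes "0 < q" and b: "q \<cdot>\<^bsub>S\<^sub>2\<^esub> b \<preceq>\<^bsub>S\<^sub>2\<^esub> p \<cdot>\<^bsub>S\<^sub>2\<^esub> w" and w: "w \<preceq>\<^bsub>S\<^sub>2\<^esub> (k + 1) \<cdot>\<^bsub>S\<^sub>2\<^esub> z"
    and less: "real p / real q < real m / real (k + 1)"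
    and carr [simp]: "b \<in> carrier S\<^sub>2" "w \<in> carrier S\<^sub>2" "z \<in> carrier S\<^sub>2"
  shows "\<phi>\<^sub>2 b \<preceq>\<^bsub>T\<^esub> \<phi>\<^sub>2 (m \<cdot>\<^bsub>S\<^sub>2\<^esub> z)"
proof (rule \<phi>\<^sub>2_leqI[where l = "q * m" and k = "p * (k + 1)"])
  have "real (p * (k + 1)) < real (q * m)"
    using less \<open>0 < q\<close> by (simp add: field_simps)
  then show "p * (k + 1) < q * m" by (simp only: of_nat_less_iff)
  have "m \<cdot>\<^bsub>S\<^sub>2\<^esub> (q \<cdot>\<^bsub>S\<^sub>2\<^esub> b) \<preceq>\<^bsub>S\<^sub>2\<^esub> m \<cdot>\<^bsub>S\<^sub>2\<^esub> (p \<cdot>\<^bsub>S\<^sub>2\<^esub> w)"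
    using b by (rule S\<^sub>2.multiple_mono) simp_all
  moreover have "(p * m) \<cdot>\<^bsub>S\<^sub>2\<^esub> w \<preceq>\<^bsub>S\<^sub>2\<^esub> (p * m) \<cdot>\<^bsub>S\<^sub>2\<^esub> ((k + 1) \<cdot>\<^bsub>S\<^sub>2\<^esub> z)"
    using w by (rule S\<^sub>2.multiple_mono) simp_all
  ultimately have "(q * m) \<cdot>\<^bsub>S\<^sub>2\<^esub> b \<preceq>\<^bsub>S\<^sub>2\<^esub> ((k + 1) * (p * m)) \<cdot>\<^bsub>S\<^sub>2\<^esub> z"
    unfolding S\<^sub>2.nat_pow_pow[OF carr(1)] S\<^sub>2.nat_pow_pow[OF carr(2)] S\<^sub>2.nat_pow_pow[OF carr(3)]
    by (rule S\<^sub>2.leq_transD) simp_all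
  then show "(q * m) \<cdot>\<^bsub>S\<^sub>2\<^esub> b \<preceq>\<^bsub>S\<^sub>2\<^esub> (p * (k + 1)) \<cdot>\<^bsub>S\<^sub>2\<^esub> (m \<cdot>\<^bsub>S\<^sub>2\<^esub> z)"
    unfolding S\<^sub>2.nat_pow_pow[OF carr(3)] by (simp only: mult.commute mult.left_commute)
qed simp_all

lemma almost_part:
  assumes "way_below S\<^sub>1 x' x"
  obtains z where "z \<in> carrier S\<^sub>2" "k \<cdot>\<^bsub>S\<^sub>2\<^esub> z \<preceq>\<^bsub>S\<^sub>2\<^esub> \<phi>\<^sub>1 x" "\<phi>\<^sub>1 x' \<preceq>\<^bsub>S\<^sub>2\<^esub> (k + 1) \<cdot>\<^bsub>S\<^sub>2\<^esub> z"
  using divisible assms unfolding almost_divisible_def by blast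

text \<open>To bound \<open>\<phi>\<^sub>2 b\<close> when \<open>q b \<le> p \<phi>\<^sub>1 x\<close>, one may replace \<open>x\<close> by the members of any increasing
  sequence with supremum \<open>x\<close>: for every \<open>b' \<lless> b\<close> the relation \<open>q b' \<lless> q b\<close> forces
  \<open>q b' \<le> p \<phi>\<^sub>1 (xs j)\<close> for some \<open>j\<close>.\<close>

lemma \<phi>\<^sub>2_leq_by_approximation:
  assumes xs: "increasing_seq S\<^sub>1 xs" "is_seq_sup S\<^sub>1 xs x"
    and b: "b \<in> carrier S\<^sub>2" "q \<cdot>\<^bsub>S\<^sub>2\<^esub> b \<preceq>\<^bsub>S\<^sub>2\<^esub> p \<cdot>\<^bsub>S\<^sub>2\<^esub> \<phi>\<^sub>1 x" and u: "u \<in> carrier T"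
    and bound: "\<And>b' j. \<lbrakk>b' \<in> carrier S\<^sub>2; q \<cdot>\<^bsub>S\<^sub>2\<^esub> b' \<preceq>\<^bsub>S\<^sub>2\<^esub> p \<cdot>\<^bsub>S\<^sub>2\<^esub> \<phi>\<^sub>1 (xs j)\<rbrakk> \<Longrightarrow> \<phi>\<^sub>2 b' \<preceq>\<^bsub>T\<^esub> u"
  shows "\<phi>\<^sub>2 b \<preceq>\<^bsub>T\<^esub> u"
proof -
  obtain bs where bs: "increasing_seq S\<^sub>2 bs" "is_seq_sup S\<^sub>2 bs b"
    "\<And>n. way_below S\<^sub>2 (bs n) (bs (Suc n))" "\<And>n. way_below S\<^sub>2 (bs n) b"
    using S\<^sub>2.way_below_approximation[OF b(1)] by blast
  have "increasing_seq S\<^sub>2 (\<lambda>j. \<phi>\<^sub>1 (xs j))" "is_seq_sup S\<^sub>2 (\<lambda>j. \<phi>\<^sub>1 (xs j)) (\<phi>\<^sub>1 x)"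
    using xs gen_cu_morphismD(5,6)[OF gen\<^sub>1] by auto
  note sup = S\<^sub>2.increasing_seq_multiple[OF this(1), of p] S\<^sub>2.is_seq_sup_multiple[OF this, of p]
  have "\<phi>\<^sub>2 (bs n) \<preceq>\<^bsub>T\<^esub> u" for n
  proof -
    obtain j where "q \<cdot>\<^bsub>S\<^sub>2\<^esub> bs n \<preceq>\<^bsub>S\<^sub>2\<^esub> p \<cdot>\<^bsub>S\<^sub>2\<^esub> \<phi>\<^sub>1 (xs j)"
      using S\<^sub>2.way_belowD[OF S\<^sub>2.way_below_multiple[OF bs(4)] sup b(2)] by blast
    then show ?thesis using bound bs(1) by simp
  qed
  then show ?thesis
    using T.is_seq_sup_least[OF gen_cu_morphismD(5)[OF gen\<^sub>2 bs(1,2)] u] by blast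
qed

text \<open>The elements of \<open>S\<^sub>2\<close> that are at most a fraction \<open>p/q < t\<close> of \<open>\<phi>\<^sub>1 x\<close>, expressed without division.
  The set is empty for \<open>t = 0\<close>.\<close>

definition fraction_below :: "'a \<Rightarrow> ennreal \<Rightarrow> 'b set" where
  "fraction_below x t = {a \<in> carrier S\<^sub>2. \<exists>p q. 0 < q \<and> ennreal (real p / real q) < t \<and>
     q \<cdot>\<^bsub>S\<^sub>2\<^esub> a \<preceq>\<^bsub>S\<^sub>2\<^esub> p \<cdot>\<^bsub>S\<^sub>2\<^esub> \<phi>\<^sub>1 x}"

lemma fraction_belowI:
  "\<lbrakk>a \<in> carrier S\<^sub>2; 0 < q; ennreal (real p / real q) < t; q \<cdot>\<^bsub>S\<^sub>2\<^esub> a \<preceq>\<^bsub>S\<^sub>2\<^esub> p \<cdot>\<^bsub>S\<^sub>2\<^esub> \<phi>\<^sub>1 x\<rbrakk>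
    \<Longrightarrow> a \<in> fraction_below x t"
  by (auto simp: fraction_below_def)

lemma fraction_belowE:
  assumes "a \<in> fraction_below x t"
  obtains p q where "a \<in> carrier S\<^sub>2" "0 < q" "ennreal (real p / real q) < t"
    "q \<cdot>\<^bsub>S\<^sub>2\<^esub> a \<preceq>\<^bsub>S\<^sub>2\<^esub> p \<cdot>\<^bsub>S\<^sub>2\<^esub> \<phi>\<^sub>1 x"
  using assms by (auto simp: fraction_below_def)

lemma fraction_below_mono:
  assumes "x \<preceq>\<^bsub>S\<^sub>1\<^esub> y" "x \<in> carrier S\<^sub>1" "y \<in> carrier S\<^sub>1" and "s \<le> t"
  shows "fraction_below x s \<subseteq> fraction_below y t"
proof
  fix a assume "a \<in> fraction_below x s"
  then obtain p q where a: "a \<in> carrier S\<^sub>2" "0 < q" "ennreal (real p / real q) < s"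
    "q \<cdot>\<^bsub>S\<^sub>2\<^esub> a \<preceq>\<^bsub>S\<^sub>2\<^esub> p \<cdot>\<^bsub>S\<^sub>2\<^esub> \<phi>\<^sub>1 x"
    by (rule fraction_belowE)
  have "p \<cdot>\<^bsub>S\<^sub>2\<^esub> \<phi>\<^sub>1 x \<preceq>\<^bsub>S\<^sub>2\<^esub> p \<cdot>\<^bsub>S\<^sub>2\<^esub> \<phi>\<^sub>1 y"
    using assms by (intro S\<^sub>2.multiple_mono \<phi>\<^sub>1_mono) auto
  then have "q \<cdot>\<^bsub>S\<^sub>2\<^esub> a \<preceq>\<^bsub>S\<^sub>2\<^esub> p \<cdot>\<^bsub>S\<^sub>2\<^esub> \<phi>\<^sub>1 y"
    using a assms by (intro S\<^sub>2.leq_transD[OF a(4)]) auto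
  then show "a \<in> fraction_below y t"
    using a assms(4) by (intro fraction_belowI) auto
qed

lemma multiple_of_part_mem:
  assumes "z \<in> carrier S\<^sub>2" "x \<in> carrier S\<^sub>1" "k \<cdot>\<^bsub>S\<^sub>2\<^esub> z \<preceq>\<^bsub>S\<^sub>2\<^esub> \<phi>\<^sub>1 x" "0 < k" "ennreal (real m / real k) < t"
  shows "m \<cdot>\<^bsub>S\<^sub>2\<^esub> z \<in> fraction_below x t"
proof (rule fraction_belowI[of _ k m])
  have "m \<cdot>\<^bsub>S\<^sub>2\<^esub> (k \<cdot>\<^bsub>S\<^sub>2\<^esub> z) \<preceq>\<^bsub>S\<^sub>2\<^esub> m \<cdot>\<^bsub>S\<^sub>2\<^esub> \<phi>\<^sub>1 x"
    using assms by (intro S\<^sub>2.multiple_mono) auto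
  then show "k \<cdot>\<^bsub>S\<^sub>2\<^esub> (m \<cdot>\<^bsub>S\<^sub>2\<^esub> z) \<preceq>\<^bsub>S\<^sub>2\<^esub> m \<cdot>\<^bsub>S\<^sub>2\<^esub> \<phi>\<^sub>1 x"
    using assms(1) by (simp add: S\<^sub>2.nat_pow_pow mult.commute)
qed (use assms in auto)

text \<open>The last conclusion says that the supremum of the sequence \<open>\<phi>\<^sub>2 (c n)\<close> dominates the image of
  the whole set \<open>fraction_below x t\<close>; this supremum is therefore its least upper bound.\<close>

lemma fraction_below_cofinal_seq:
  assumes x: "x \<in> carrier S\<^sub>1" and t: "t \<noteq> 0"
  obtains c where "\<And>n. c n \<in> fraction_below x t" "increasing_seq T (\<lambda>n. \<phi>\<^sub>2 (c n))"
    "\<And>s b. \<lbrakk>is_seq_sup T (\<lambda>n. \<phi>\<^sub>2 (c n)) s; b \<in> fraction_below x t\<rbrakk> \<Longrightarrow> \<phi>\<^sub>2 b \<preceq>\<^bsub>T\<^esub> s"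
proof -
  obtain xs where xs: "increasing_seq S\<^sub>1 xs" "is_seq_sup S\<^sub>1 xs x"
    "\<And>n. way_below S\<^sub>1 (xs n) (xs (Suc n))" "\<And>n. way_below S\<^sub>1 (xs n) x"
    using S\<^sub>1.way_below_approximation[OF x] by blast
  obtain r where r: "\<And>n. 0 < r n" "\<And>n. r n < r (Suc n)" "\<And>n. ennreal (r n) < t"
    "\<And>c. \<lbrakk>0 \<le> c; ennreal c < t\<rbrakk> \<Longrightarrow> \<exists>n. c < r n"
    using strict_approximation_from_below[OF t] by metis
  \<comment> \<open>The candidate for \<open>c n\<close>: a multiple of an almost part of \<open>\<phi>\<^sub>1 (xs (Suc n))\<close> that dominates
    everything below the fraction \<open>r n\<close> of \<open>\<phi>\<^sub>1 (xs n)\<close>. Such elements are automatically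
    increasing in \<open>n\<close> under \<open>\<phi>\<^sub>2\<close>.\<close>
  have "\<exists>a. a \<in> fraction_below (xs (Suc n)) (ennreal (r (Suc n))) \<and>
      (\<forall>b\<in>carrier S\<^sub>2. \<forall>p q. 0 < q \<and> real p / real q \<le> r n \<and>
         q \<cdot>\<^bsub>S\<^sub>2\<^esub> b \<preceq>\<^bsub>S\<^sub>2\<^esub> p \<cdot>\<^bsub>S\<^sub>2\<^esub> \<phi>\<^sub>1 (xs n) \<longrightarrow> \<phi>\<^sub>2 b \<preceq>\<^bsub>T\<^esub> \<phi>\<^sub>2 a)" (is "\<exists>a. ?P n a") for n
  proof -
    have "ennreal (r n) < ennreal (r (Suc n))"
      using r(1,2) by (simp add: ennreal_less_iff less_imp_le)
    then obtain k m where m: "0 < k" "ennreal (real m / real k) < ennreal (r (Suc n))"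
        "r n < real m / real (k + 1)"
      by (rule fraction_between[OF less_imp_le[OF r(1)]])
    obtain z where z: "z \<in> carrier S\<^sub>2" "k \<cdot>\<^bsub>S\<^sub>2\<^esub> z \<preceq>\<^bsub>S\<^sub>2\<^esub> \<phi>\<^sub>1 (xs (Suc n))"
        "\<phi>\<^sub>1 (xs n) \<preceq>\<^bsub>S\<^sub>2\<^esub> (k + 1) \<cdot>\<^bsub>S\<^sub>2\<^esub> z"
      using almost_part[OF xs(3)] by blast
    have "m \<cdot>\<^bsub>S\<^sub>2\<^esub> z \<in> fraction_below (xs (Suc n)) (ennreal (r (Suc n)))"
      using z m xs(1) by (intro multiple_of_part_mem) auto
    moreover have "\<phi>\<^sub>2 b \<preceq>\<^bsub>T\<^esub> \<phi>\<^sub>2 (m \<cdot>\<^bsub>S\<^sub>2\<^esub> z)"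
      if "b \<in> carrier S\<^sub>2" "0 < q" "real p / real q \<le> r n" "q \<cdot>\<^bsub>S\<^sub>2\<^esub> b \<preceq>\<^bsub>S\<^sub>2\<^esub> p \<cdot>\<^bsub>S\<^sub>2\<^esub> \<phi>\<^sub>1 (xs n)" for b p q
      using \<phi>\<^sub>2_leq_multipleI[OF that(2,4) z(3) le_less_trans[OF that(3) m(3)]] that(1) z(1) xs(1)
      by simp
    ultimately show ?thesis by blast
  qed
  then obtain c where c: "\<And>n. ?P n (c n)" by metis
  have c_mem: "c n \<in> fraction_below x t" for n
  proof -
    have "fraction_below (xs (Suc n)) (ennreal (r (Suc n))) \<subseteq> fraction_below x t"
      using xs(1) x r(3)[of "Suc n"] S\<^sub>1.is_seq_sup_upper[OF xs(2)]
      by (intro fraction_below_mono) auto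
    then show ?thesis using c by blast
  qed
  then have c_carr: "c n \<in> carrier S\<^sub>2" for n by (auto simp: fraction_below_def)
  have "\<phi>\<^sub>2 (c n) \<preceq>\<^bsub>T\<^esub> \<phi>\<^sub>2 (c (Suc n))" for n
  proof -
    obtain p q where pq: "0 < q" "ennreal (real p / real q) < ennreal (r (Suc n))"
      "q \<cdot>\<^bsub>S\<^sub>2\<^esub> c n \<preceq>\<^bsub>S\<^sub>2\<^esub> p \<cdot>\<^bsub>S\<^sub>2\<^esub> \<phi>\<^sub>1 (xs (Suc n))"
      using c[of n] by (auto elim: fraction_belowE)
    then have "real p / real q \<le> r (Suc n)" by (simp add: ennreal_less_iff)
    then show ?thesis using c[of "Suc n"] c_carr[of n] pq(1,3) by blast
  qed
  then have inc: "increasing_seq T (\<lambda>n. \<phi>\<^sub>2 (c n))"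
    using c_carr by (intro T.increasing_seq_SucI) auto
  have "\<phi>\<^sub>2 b \<preceq>\<^bsub>T\<^esub> s" if s: "is_seq_sup T (\<lambda>n. \<phi>\<^sub>2 (c n)) s" and b: "b \<in> fraction_below x t" for s b
  proof -
    obtain p q where pq: "b \<in> carrier S\<^sub>2" "0 < q" "ennreal (real p / real q) < t"
      "q \<cdot>\<^bsub>S\<^sub>2\<^esub> b \<preceq>\<^bsub>S\<^sub>2\<^esub> p \<cdot>\<^bsub>S\<^sub>2\<^esub> \<phi>\<^sub>1 x"
      using b by (rule fraction_belowE)
    obtain i where i: "real p / real q < r i" using r(4)[OF _ pq(3)] by auto
    have "incseq r" using r(2) by (intro incseq_SucI less_imp_le)
    show ?thesis
    proof (rule \<phi>\<^sub>2_leq_by_approximation[OF xs(1,2) pq(1,4)])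
      show "s \<in> carrier T" using s by (rule T.is_seq_sup_carrier)
      fix b' j
      assume b': "b' \<in> carrier S\<^sub>2" "q \<cdot>\<^bsub>S\<^sub>2\<^esub> b' \<preceq>\<^bsub>S\<^sub>2\<^esub> p \<cdot>\<^bsub>S\<^sub>2\<^esub> \<phi>\<^sub>1 (xs j)"
      define n where "n = max i j"
      have "real p / real q \<le> r n"
        using i incseqD[OF \<open>incseq r\<close>, of i n] by (simp add: n_def)
      moreover have "p \<cdot>\<^bsub>S\<^sub>2\<^esub> \<phi>\<^sub>1 (xs j) \<preceq>\<^bsub>S\<^sub>2\<^esub> p \<cdot>\<^bsub>S\<^sub>2\<^esub> \<phi>\<^sub>1 (xs n)"
        using xs(1) by (intro S\<^sub>2.multiple_mono \<phi>\<^sub>1_mono S\<^sub>1.increasing_seq_le) (auto simp: n_def)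
      then have "q \<cdot>\<^bsub>S\<^sub>2\<^esub> b' \<preceq>\<^bsub>S\<^sub>2\<^esub> p \<cdot>\<^bsub>S\<^sub>2\<^esub> \<phi>\<^sub>1 (xs n)"
        using b'(1) xs(1) by (intro S\<^sub>2.leq_transD[OF b'(2)]) auto
      ultimately have "\<phi>\<^sub>2 b' \<preceq>\<^bsub>T\<^esub> \<phi>\<^sub>2 (c n)"
        using c[of n] b'(1) pq(2) by blast
      then show "\<phi>\<^sub>2 b' \<preceq>\<^bsub>T\<^esub> s"
        by (rule T.leq_transD) (use T.is_seq_sup_upper[OF s] T.is_seq_sup_carrier[OF s] b'(1) c_carr in auto)
    qed
  qed
  with c_mem inc that show thesis by blast
qed

text \<open>The real multiple \<open>t \<phi>\<^sub>2 (\<phi>\<^sub>1 x)\<close>, for \<open>t \<noteq> 0\<close>: the least upper bound of \<open>\<phi>\<^sub>2 ` fraction_below x t\<close>.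
  Suprema of arbitrary subsets need not exist in \<open>T\<close>, so it is selected by its defining
  property, and its existence is part of \<open>soft_multiple_lub\<close>.\<close>

definition soft_multiple :: "'a \<Rightarrow> ennreal \<Rightarrow> 't" where
  "soft_multiple x t = (SOME s. s \<in> carrier T \<and> (\<forall>a\<in>fraction_below x t. \<phi>\<^sub>2 a \<preceq>\<^bsub>T\<^esub> s) \<and>
     (\<forall>u\<in>carrier T. (\<forall>a\<in>fraction_below x t. \<phi>\<^sub>2 a \<preceq>\<^bsub>T\<^esub> u) \<longrightarrow> s \<preceq>\<^bsub>T\<^esub> u))"

lemma soft_multiple_lub:
  assumes x: "x \<in> carrier S\<^sub>1" and t: "t \<noteq> 0"
  shows soft_multiple_closed: "soft_multiple x t \<in> carrier T"
    and soft_multiple_upper: "a \<in> fraction_below x t \<Longrightarrow> \<phi>\<^sub>2 a \<preceq>\<^bsub>T\<^esub> soft_multiple x t"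
    and soft_multiple_least:
      "\<lbrakk>u \<in> carrier T; \<And>a. a \<in> fraction_below x t \<Longrightarrow> \<phi>\<^sub>2 a \<preceq>\<^bsub>T\<^esub> u\<rbrakk> \<Longrightarrow> soft_multiple x t \<preceq>\<^bsub>T\<^esub> u"
proof -
  obtain c where c: "\<And>n. c n \<in> fraction_below x t" "increasing_seq T (\<lambda>n. \<phi>\<^sub>2 (c n))"
    "\<And>s b. \<lbrakk>is_seq_sup T (\<lambda>n. \<phi>\<^sub>2 (c n)) s; b \<in> fraction_below x t\<rbrakk> \<Longrightarrow> \<phi>\<^sub>2 b \<preceq>\<^bsub>T\<^esub> s"
    using fraction_below_cofinal_seq[OF x t] by blast
  obtain s where s: "is_seq_sup T (\<lambda>n. \<phi>\<^sub>2 (c n)) s" using T.O1[OF c(2)] by blast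
  have "\<exists>s. s \<in> carrier T \<and> (\<forall>a\<in>fraction_below x t. \<phi>\<^sub>2 a \<preceq>\<^bsub>T\<^esub> s) \<and>
     (\<forall>u\<in>carrier T. (\<forall>a\<in>fraction_below x t. \<phi>\<^sub>2 a \<preceq>\<^bsub>T\<^esub> u) \<longrightarrow> s \<preceq>\<^bsub>T\<^esub> u)"
    using T.is_seq_sup_carrier[OF s] c(3)[OF s] T.is_seq_sup_least[OF s] c(1) by blast
  note lub = someI_ex[OF this, folded soft_multiple_def]
  show "soft_multiple x t \<in> carrier T" using lub by blast
  show "a \<in> fraction_below x t \<Longrightarrow> \<phi>\<^sub>2 a \<preceq>\<^bsub>T\<^esub> soft_multiple x t" using lub by blast
  show "\<lbrakk>u \<in> carrier T; \<And>a. a \<in> fraction_below x t \<Longrightarrow> \<phi>\<^sub>2 a \<preceq>\<^bsub>T\<^esub> u\<rbrakk> \<Longrightarrow> soft_multiple x t \<preceq>\<^bsub>T\<^esub> u"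
    using lub by blast
qed

lemma soft_multiple_seq:
  assumes x: "x \<in> carrier S\<^sub>1" and t: "t \<noteq> 0"
  obtains c where "\<And>n. c n \<in> fraction_below x t" "increasing_seq T (\<lambda>n. \<phi>\<^sub>2 (c n))"
    "is_seq_sup T (\<lambda>n. \<phi>\<^sub>2 (c n)) (soft_multiple x t)"
proof -
  obtain c where c: "\<And>n. c n \<in> fraction_below x t" "increasing_seq T (\<lambda>n. \<phi>\<^sub>2 (c n))"
    "\<And>s b. \<lbrakk>is_seq_sup T (\<lambda>n. \<phi>\<^sub>2 (c n)) s; b \<in> fraction_below x t\<rbrakk> \<Longrightarrow> \<phi>\<^sub>2 b \<preceq>\<^bsub>T\<^esub> s"
    using fraction_below_cofinal_seq[OF x t] by blast
  obtain s where s: "is_seq_sup T (\<lambda>n. \<phi>\<^sub>2 (c n)) s" using T.O1[OF c(2)] by blast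
  have "soft_multiple x t = s"
    using s x t c(1) T.is_seq_sup_carrier[OF s]
    by (intro T.leq_antisymD soft_multiple_least T.is_seq_sup_least[OF s] soft_multiple_upper
        soft_multiple_closed) (auto intro: c(3))
  then show thesis using that c(1,2) s by blast
qed

end


section \<open>The pairing with the Cuntz semigroup of the Jiang--Su algebra\<close>

lemma Cu_jiang_su_simps [simp]:
  "mult Cu_jiang_su = jiang_su_add" "one Cu_jiang_su = Compact 0" "leq Cu_jiang_su = jiang_su_leq"
  "Compact n \<in> carrier Cu_jiang_su" "Soft t \<in> carrier Cu_jiang_su \<longleftrightarrow> t \<noteq> 0"
  by (auto simp: Cu_jiang_su_def)

text \<open>The number underlying an element of \<open>Z\<close>; the compact and the soft element \<open>n\<close> have the same
  value.\<close>

fun jiang_su_value :: "jiang_su \<Rightarrow> ennreal" where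
  "jiang_su_value (Compact n) = of_nat n"
| "jiang_su_value (Soft t) = t"

lemma jiang_su_value_add [simp]:
  "jiang_su_value (jiang_su_add y y') = jiang_su_value y + jiang_su_value y'"
  by (cases y; cases y') simp_all

lemma jiang_su_value_eq_0: "y \<in> carrier Cu_jiang_su \<Longrightarrow> jiang_su_value y = 0 \<longleftrightarrow> y = Compact 0"
  by (cases y) auto

lemma jiang_su_leq_SoftI: "jiang_su_value y < t \<Longrightarrow> jiang_su_leq y (Soft t)"
  by (cases y) auto

text \<open>Compact elements of \<open>Z\<close> are suprema only of sequences that reach them: elements of \<open>Z\<close>
  strictly below the compact \<open>n\<close> are below the soft \<open>n\<close>.\<close>

lemma Cu_jiang_su_sup_Compact:
  assumes z: "increasing_seq Cu_jiang_su z" "is_seq_sup Cu_jiang_su z (Compact n)"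
  obtains j where "z j = Compact n"
proof (rule ccontr)
  assume "\<not> thesis"
  then have ne: "z j \<noteq> Compact n" for j using that by blast
  have carr: "z j \<in> carrier Cu_jiang_su" and le: "jiang_su_leq (z j) (Compact n)" for j
    using z by (auto simp: increasing_seq_def is_seq_sup_def)
  have "n \<noteq> 0"
  proof
    assume "n = 0"
    then show False using carr[of 0] le[of 0] ne[of 0] by (cases "z 0") auto
  qed
  moreover have "jiang_su_leq (z j) (Soft (of_nat n))" for j
    using le[of j] ne[of j] by (cases "z j") auto
  ultimately have "jiang_su_leq (Compact n) (Soft (of_nat n))"
    using z(2) unfolding is_seq_sup_def by (simp del: jiang_su_leq.simps)
  then show False by simp
qed

lemma Cu_jiang_su_sup_Soft:
  assumes z: "is_seq_sup Cu_jiang_su z (Soft t)" and r: "r < t"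
  obtains j where "r < jiang_su_value (z j)"
proof (rule ccontr)
  assume "\<not> thesis"
  then have le: "jiang_su_value (z j) \<le> r" for j using that not_less by blast
  obtain c where c: "r < c" "c < t" using dense[OF r] by blast
  have "jiang_su_leq (z j) (Soft c)" for j
    using le_less_trans[OF le c(1)] by (rule jiang_su_leq_SoftI)
  moreover have "c \<noteq> 0" using c(1) by auto
  ultimately have "jiang_su_leq (Soft t) (Soft c)"
    using z unfolding is_seq_sup_def by (simp del: jiang_su_leq.simps)
  then show False using c(2) by simp
qed

lemma Cu_jiang_su_way_below_Soft:
  assumes "way_below Cu_jiang_su y (Soft t)"
  obtains r where "0 < r" "ennreal r < t" "jiang_su_leq y (Soft (ennreal r))"
proof -
  have t: "t \<noteq> 0" using assms by (simp add: way_below_def)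
  obtain r where r: "\<And>n. 0 < r n" "\<And>n. r n < r (Suc n)" "\<And>n. ennreal (r n) < t"
    "\<And>c. \<lbrakk>0 \<le> c; ennreal c < t\<rbrakk> \<Longrightarrow> \<exists>n. c < r n"
    using strict_approximation_from_below[OF t] by blast
  have "incseq r" using r(2) by (intro incseq_SucI less_imp_le)
  then have inc: "increasing_seq Cu_jiang_su (\<lambda>n. Soft (ennreal (r n)))"
    using r(1) by (auto simp: increasing_seq_def monotone_on_def incseq_def ennreal_leI ennreal_eq_0_iff not_le)
  have least: "t \<le> u" if "\<And>n. ennreal (r n) \<le> u" for u
  proof (rule ccontr)
    assume "\<not> t \<le> u"
    then obtain c where c: "u < c" "c < t" using dense[of u t] by (auto simp: not_le)
    then obtain d where d: "c = ennreal d" "0 \<le> d" by (cases c) (auto simp: top_unique)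
    then obtain n where "d < r n" using r(4) c(2) by blast
    then have "c \<le> ennreal (r n)" using d by (simp add: ennreal_leI)
    then show False using c(1) that[of n] by simp
  qed
  have sup: "is_seq_sup Cu_jiang_su (\<lambda>n. Soft (ennreal (r n))) (Soft t)"
    unfolding is_seq_sup_def
  proof (intro conjI ballI allI impI)
    fix u assume "\<forall>n. Soft (ennreal (r n)) \<preceq>\<^bsub>Cu_jiang_su\<^esub> u"
    then show "Soft t \<preceq>\<^bsub>Cu_jiang_su\<^esub> u"
      using least by (cases u) auto
  qed (use t less_imp_le[OF r(3)] in auto)
  have "\<exists>n. y \<preceq>\<^bsub>Cu_jiang_su\<^esub> Soft (ennreal (r n))"
    using assms inc sup unfolding way_below_def by fastforce
  then show thesis using that r(1,3) by auto
qed

context divisible_unperforated_pair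
begin

text \<open>The bimorphism \<open>S\<^sub>1 \<times> Z \<rightarrow> T\<close>. The value at \<open>Soft 0\<close>, which is not in the carrier of \<open>Z\<close>, is
  irrelevant.\<close>

fun pairing :: "'a \<Rightarrow> jiang_su \<Rightarrow> 't" where
  "pairing x (Compact n) = n \<cdot>\<^bsub>T\<^esub> \<phi>\<^sub>2 (\<phi>\<^sub>1 x)"
| "pairing x (Soft t) = soft_multiple x t"

lemma pairing_closed [simp]:
  "\<lbrakk>x \<in> carrier S\<^sub>1; y \<in> carrier Cu_jiang_su\<rbrakk> \<Longrightarrow> pairing x y \<in> carrier T"
  by (cases y) (auto intro: soft_multiple_closed)

lemma pairing_upper:
  assumes x: "x \<in> carrier S\<^sub>1" and y: "y \<in> carrier Cu_jiang_su"
    and a: "a \<in> fraction_below x (jiang_su_value y)"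
  shows "\<phi>\<^sub>2 a \<preceq>\<^bsub>T\<^esub> pairing x y"
proof (cases y)
  case (Soft t)
  then show ?thesis using soft_multiple_upper[OF x] y a by simp
next
  case (Compact n)
  obtain p q where pq: "a \<in> carrier S\<^sub>2" "0 < q" "ennreal (real p / real q) < of_nat n"
    "q \<cdot>\<^bsub>S\<^sub>2\<^esub> a \<preceq>\<^bsub>S\<^sub>2\<^esub> p \<cdot>\<^bsub>S\<^sub>2\<^esub> \<phi>\<^sub>1 x"
    using a Compact by (auto elim: fraction_belowE)
  have "real p / real q < real n"
    using pq(3) by (simp add: ennreal_of_nat_eq_real_of_nat ennreal_less_iff)
  then have "real p < real (q * n)" using pq(2) by (simp add: field_simps)
  then have "p < q * n" by (simp only: of_nat_less_iff)
  moreover have "n \<cdot>\<^bsub>S\<^sub>2\<^esub> (q \<cdot>\<^bsub>S\<^sub>2\<^esub> a) \<preceq>\<^bsub>S\<^sub>2\<^esub> n \<cdot>\<^bsub>S\<^sub>2\<^esub> (p \<cdot>\<^bsub>S\<^sub>2\<^esub> \<phi>\<^sub>1 x)"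
    using pq x by (intro S\<^sub>2.multiple_mono) auto
  then have "(q * n) \<cdot>\<^bsub>S\<^sub>2\<^esub> a \<preceq>\<^bsub>S\<^sub>2\<^esub> p \<cdot>\<^bsub>S\<^sub>2\<^esub> (n \<cdot>\<^bsub>S\<^sub>2\<^esub> \<phi>\<^sub>1 x)"
    using pq(1) x by (simp add: S\<^sub>2.nat_pow_pow mult.commute)
  ultimately have "\<phi>\<^sub>2 a \<preceq>\<^bsub>T\<^esub> \<phi>\<^sub>2 (n \<cdot>\<^bsub>S\<^sub>2\<^esub> \<phi>\<^sub>1 x)"
    using pq(1) x by (intro \<phi>\<^sub>2_leqI) auto
  then show ?thesis using x by (simp add: Compact \<phi>\<^sub>2_multiple)
qed

lemma pairing_mono_right:
  assumes x: "x \<in> carrier S\<^sub>1" and y: "y \<in> carrier Cu_jiang_su" "y' \<in> carrier Cu_jiang_su"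
    and le: "jiang_su_leq y y'"
  shows "pairing x y \<preceq>\<^bsub>T\<^esub> pairing x y'"
proof (cases y)
  case (Soft t)
  have "t \<le> jiang_su_value y'" using le Soft by (cases y') auto
  then have "fraction_below x t \<subseteq> fraction_below x (jiang_su_value y')"
    using x by (intro fraction_below_mono) auto
  then show ?thesis
    using x y Soft by (auto intro!: soft_multiple_least pairing_upper)
next
  case (Compact n)
  show ?thesis
  proof (cases y')
    case (Compact n')
    then show ?thesis using x le \<open>y = Compact n\<close> by (auto intro: T.multiple_mono_nat)
  next
    case (Soft t)
    have "n \<cdot>\<^bsub>S\<^sub>2\<^esub> \<phi>\<^sub>1 x \<in> fraction_below x t"
      using le x Compact Soft
      by (intro fraction_belowI[of _ 1 n]) (auto simp: ennreal_of_nat_eq_real_of_nat)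
    then have "\<phi>\<^sub>2 (n \<cdot>\<^bsub>S\<^sub>2\<^esub> \<phi>\<^sub>1 x) \<preceq>\<^bsub>T\<^esub> pairing x y'"
      using pairing_upper[OF x y(2)] Soft by simp
    then show ?thesis using x by (simp add: Compact \<phi>\<^sub>2_multiple)
  qed
qed

text \<open>Every value of the pairing is the supremum of an increasing sequence \<open>\<phi>\<^sub>2 (c n)\<close>, where \<open>c n\<close>
  is at most a fraction of \<open>\<phi>\<^sub>1 x\<close>. For soft \<open>y\<close> the fraction is strictly smaller than \<open>y\<close>, for
  compact \<open>y\<close> it may be equal. A sum with at least one soft summand thus still has a strict bound.\<close>

lemma pairing_seq:
  assumes x: "x \<in> carrier S\<^sub>1" and y: "y \<in> carrier Cu_jiang_su"
  obtains c where "\<And>n. c n \<in> carrier S\<^sub>2" "increasing_seq T (\<lambda>n. \<phi>\<^sub>2 (c n))"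
    "is_seq_sup T (\<lambda>n. \<phi>\<^sub>2 (c n)) (pairing x y)"
    "\<And>n. \<exists>p q. 0 < q \<and> q \<cdot>\<^bsub>S\<^sub>2\<^esub> c n \<preceq>\<^bsub>S\<^sub>2\<^esub> p \<cdot>\<^bsub>S\<^sub>2\<^esub> \<phi>\<^sub>1 x \<and>
       (ennreal (real p / real q) < jiang_su_value y \<or>
        y \<in> range Compact \<and> ennreal (real p / real q) = jiang_su_value y)"
proof (cases y)
  case (Compact m)
  show thesis
  proof (rule that[of "\<lambda>_. m \<cdot>\<^bsub>S\<^sub>2\<^esub> \<phi>\<^sub>1 x"])
    show "\<exists>p q. 0 < q \<and> q \<cdot>\<^bsub>S\<^sub>2\<^esub> (m \<cdot>\<^bsub>S\<^sub>2\<^esub> \<phi>\<^sub>1 x) \<preceq>\<^bsub>S\<^sub>2\<^esub> p \<cdot>\<^bsub>S\<^sub>2\<^esub> \<phi>\<^sub>1 x \<and>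
       (ennreal (real p / real q) < jiang_su_value y \<or>
        y \<in> range Compact \<and> ennreal (real p / real q) = jiang_su_value y)"
      using x Compact by (intro exI[of _ m] exI[of _ 1]) (auto simp: ennreal_of_nat_eq_real_of_nat)
  qed (use x Compact in \<open>auto simp: \<phi>\<^sub>2_multiple increasing_seq_def monotone_on_def is_seq_sup_def\<close>)
next
  case (Soft t)
  then have t: "t \<noteq> 0" using y by simp
  obtain c where c: "\<And>n. c n \<in> fraction_below x t" "increasing_seq T (\<lambda>n. \<phi>\<^sub>2 (c n))"
    "is_seq_sup T (\<lambda>n. \<phi>\<^sub>2 (c n)) (soft_multiple x t)"
    using soft_multiple_seq[OF x t] by blast
  show thesis
  proof (rule that[of c])
    fix n
    show "\<exists>p q. 0 < q \<and> q \<cdot>\<^bsub>S\<^sub>2\<^esub> c n \<preceq>\<^bsub>S\<^sub>2\<^esub> p \<cdot>\<^bsub>S\<^sub>2\<^esub> \<phi>\<^sub>1 x \<and>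
       (ennreal (real p / real q) < jiang_su_value y \<or>
        y \<in> range Compact \<and> ennreal (real p / real q) = jiang_su_value y)"
      using c(1)[of n] Soft by (auto simp: fraction_below_def)
  qed (use c Soft in \<open>auto simp: fraction_below_def\<close>)
qed

lemma fraction_below_add:
  assumes x: "x \<in> carrier S\<^sub>1" and ab: "a \<in> carrier S\<^sub>2" "b \<in> carrier S\<^sub>2" and q: "0 < q" "0 < q'"
    and a: "q \<cdot>\<^bsub>S\<^sub>2\<^esub> a \<preceq>\<^bsub>S\<^sub>2\<^esub> p \<cdot>\<^bsub>S\<^sub>2\<^esub> \<phi>\<^sub>1 x" and b: "q' \<cdot>\<^bsub>S\<^sub>2\<^esub> b \<preceq>\<^bsub>S\<^sub>2\<^esub> p' \<cdot>\<^bsub>S\<^sub>2\<^esub> \<phi>\<^sub>1 x"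
    and less: "ennreal (real p / real q) + ennreal (real p' / real q') < t"
  shows "a \<oplus>\<^bsub>S\<^sub>2\<^esub> b \<in> fraction_below x t"
proof (rule fraction_belowI[of _ "q * q'" "p * q' + p' * q"])
  have "real (p * q' + p' * q) / real (q * q') = real p / real q + real p' / real q'"
    using q by (simp add: field_simps)
  then show "ennreal (real (p * q' + p' * q) / real (q * q')) < t"
    using less by simp
  have "q' \<cdot>\<^bsub>S\<^sub>2\<^esub> (q \<cdot>\<^bsub>S\<^sub>2\<^esub> a) \<oplus>\<^bsub>S\<^sub>2\<^esub> q \<cdot>\<^bsub>S\<^sub>2\<^esub> (q' \<cdot>\<^bsub>S\<^sub>2\<^esub> b) \<preceq>\<^bsub>S\<^sub>2\<^esub>
      q' \<cdot>\<^bsub>S\<^sub>2\<^esub> (p \<cdot>\<^bsub>S\<^sub>2\<^esub> \<phi>\<^sub>1 x) \<oplus>\<^bsub>S\<^sub>2\<^esub> q \<cdot>\<^bsub>S\<^sub>2\<^esub> (p' \<cdot>\<^bsub>S\<^sub>2\<^esub> \<phi>\<^sub>1 x)"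
    using a b ab x by (intro S\<^sub>2.add_mono S\<^sub>2.multiple_mono) auto
  then show "(q * q') \<cdot>\<^bsub>S\<^sub>2\<^esub> (a \<oplus>\<^bsub>S\<^sub>2\<^esub> b) \<preceq>\<^bsub>S\<^sub>2\<^esub> (p * q' + p' * q) \<cdot>\<^bsub>S\<^sub>2\<^esub> \<phi>\<^sub>1 x"
    using ab x by (simp add: S\<^sub>2.nat_pow_pow S\<^sub>2.nat_pow_mult S\<^sub>2.multiple_add mult.commute[of q' q])
qed (use ab q in auto)

text \<open>Subadditivity in the second variable, for all combinations of compact and soft elements.\<close>

lemma pairing_add_leq:
  assumes x: "x \<in> carrier S\<^sub>1" and y: "y \<in> carrier Cu_jiang_su" "y' \<in> carrier Cu_jiang_su"
    and nz: "y \<noteq> Compact 0" "y' \<noteq> Compact 0"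
    and a: "a \<in> fraction_below x (jiang_su_value y + jiang_su_value y')"
  shows "\<phi>\<^sub>2 a \<preceq>\<^bsub>T\<^esub> pairing x y \<oplus>\<^bsub>T\<^esub> pairing x y'"
proof -
  obtain p q where pq: "a \<in> carrier S\<^sub>2" "0 < q"
    "ennreal (real p / real q) < jiang_su_value y + jiang_su_value y'"
    "q \<cdot>\<^bsub>S\<^sub>2\<^esub> a \<preceq>\<^bsub>S\<^sub>2\<^esub> p \<cdot>\<^bsub>S\<^sub>2\<^esub> \<phi>\<^sub>1 x"
    using a by (rule fraction_belowE)
  have nz': "jiang_su_value y \<noteq> 0" "jiang_su_value y' \<noteq> 0"
    using y nz jiang_su_value_eq_0 by auto
  obtain r r' where r: "0 \<le> r" "0 \<le> r'" "ennreal r < jiang_su_value y" "ennreal r' < jiang_su_value y'"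
    "real p / real q < r + r'"
    using less_add_split[OF _ pq(3) nz'] by auto
  obtain K where K: "\<forall>k\<ge>K. 0 < k \<and>
    (\<exists>m. ennreal (real m / real k) < jiang_su_value y \<and> r < real m / real (k + 1))"
    using eventually_fraction_between[OF r(1,3)] by blast
  obtain K' where K': "\<forall>k\<ge>K'. 0 < k \<and>
    (\<exists>m. ennreal (real m / real k) < jiang_su_value y' \<and> r' < real m / real (k + 1))"
    using eventually_fraction_between[OF r(2,4)] by blast
  define k where "k = max K K'"
  obtain m m' where k: "0 < k"
    and m: "ennreal (real m / real k) < jiang_su_value y" "r < real m / real (k + 1)"
    and m': "ennreal (real m' / real k) < jiang_su_value y'" "r' < real m' / real (k + 1)"
    using K[rule_format, of k] K'[rule_format, of k] by (auto simp: k_def)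
  have less: "real p / real q < real (m + m') / real (k + 1)"
    using r(5) m(2) m'(2) by (simp add: add_divide_distrib)
  obtain xs where xs: "increasing_seq S\<^sub>1 xs" "is_seq_sup S\<^sub>1 xs x"
    "\<And>n. way_below S\<^sub>1 (xs n) (xs (Suc n))" "\<And>n. way_below S\<^sub>1 (xs n) x"
    using S\<^sub>1.way_below_approximation[OF x] by blast
  show ?thesis
  proof (rule \<phi>\<^sub>2_leq_by_approximation[OF xs(1,2) pq(1,4)])
    show "pairing x y \<oplus>\<^bsub>T\<^esub> pairing x y' \<in> carrier T" using x y by simp
    fix b j assume b: "b \<in> carrier S\<^sub>2" "q \<cdot>\<^bsub>S\<^sub>2\<^esub> b \<preceq>\<^bsub>S\<^sub>2\<^esub> p \<cdot>\<^bsub>S\<^sub>2\<^esub> \<phi>\<^sub>1 (xs j)"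
    obtain z where z: "z \<in> carrier S\<^sub>2" "k \<cdot>\<^bsub>S\<^sub>2\<^esub> z \<preceq>\<^bsub>S\<^sub>2\<^esub> \<phi>\<^sub>1 x" "\<phi>\<^sub>1 (xs j) \<preceq>\<^bsub>S\<^sub>2\<^esub> (k + 1) \<cdot>\<^bsub>S\<^sub>2\<^esub> z"
      by (rule almost_part[OF xs(4)])
    have "\<phi>\<^sub>2 b \<preceq>\<^bsub>T\<^esub> \<phi>\<^sub>2 ((m + m') \<cdot>\<^bsub>S\<^sub>2\<^esub> z)"
      using \<phi>\<^sub>2_leq_multipleI[OF pq(2) b(2) z(3) less] b(1) z(1) xs(1) by simp
    also have "\<phi>\<^sub>2 ((m + m') \<cdot>\<^bsub>S\<^sub>2\<^esub> z) = \<phi>\<^sub>2 (m \<cdot>\<^bsub>S\<^sub>2\<^esub> z) \<oplus>\<^bsub>T\<^esub> \<phi>\<^sub>2 (m' \<cdot>\<^bsub>S\<^sub>2\<^esub> z)"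
      using z(1) by (simp add: \<phi>\<^sub>2_add flip: S\<^sub>2.nat_pow_mult)
    finally have "\<phi>\<^sub>2 b \<preceq>\<^bsub>T\<^esub> \<phi>\<^sub>2 (m \<cdot>\<^bsub>S\<^sub>2\<^esub> z) \<oplus>\<^bsub>T\<^esub> \<phi>\<^sub>2 (m' \<cdot>\<^bsub>S\<^sub>2\<^esub> z)" .
    moreover have "\<phi>\<^sub>2 (m \<cdot>\<^bsub>S\<^sub>2\<^esub> z) \<oplus>\<^bsub>T\<^esub> \<phi>\<^sub>2 (m' \<cdot>\<^bsub>S\<^sub>2\<^esub> z) \<preceq>\<^bsub>T\<^esub> pairing x y \<oplus>\<^bsub>T\<^esub> pairing x y'"
      using x y z k m(1) m'(1) by (intro T.add_mono pairing_upper multiple_of_part_mem) auto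
    ultimately show "\<phi>\<^sub>2 b \<preceq>\<^bsub>T\<^esub> pairing x y \<oplus>\<^bsub>T\<^esub> pairing x y'"
      by (rule T.leq_transD) (use b(1) z(1) x y in auto)
  qed
qed

lemma pairing_add_right:
  assumes x: "x \<in> carrier S\<^sub>1" and y: "y \<in> carrier Cu_jiang_su" "y' \<in> carrier Cu_jiang_su"
  shows "pairing x (jiang_su_add y y') = pairing x y \<oplus>\<^bsub>T\<^esub> pairing x y'"
proof -
  have eq: "pairing x (Soft t) = pairing x y \<oplus>\<^bsub>T\<^esub> pairing x y'"
    if sum: "jiang_su_add y y' = Soft t" and nz: "y \<noteq> Compact 0" "y' \<noteq> Compact 0" for t
  proof (rule T.leq_antisymD)
    have t: "t = jiang_su_value y + jiang_su_value y'" using arg_cong[OF sum, of jiang_su_value] by simp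
    then have t0: "t \<noteq> 0" using jiang_su_value_eq_0 y nz by auto
    have carr: "Soft t \<in> carrier Cu_jiang_su" using t0 by simp
    show "pairing x (Soft t) \<in> carrier T" "pairing x y \<oplus>\<^bsub>T\<^esub> pairing x y' \<in> carrier T"
      using x y carr by (auto simp del: pairing.simps)
    show "pairing x (Soft t) \<preceq>\<^bsub>T\<^esub> pairing x y \<oplus>\<^bsub>T\<^esub> pairing x y'"
      unfolding pairing.simps
      by (rule soft_multiple_least[OF x t0]) (use x y nz t in \<open>auto intro: pairing_add_leq\<close>)
    obtain c where c: "\<And>n. c n \<in> carrier S\<^sub>2" "increasing_seq T (\<lambda>n. \<phi>\<^sub>2 (c n))"
      "is_seq_sup T (\<lambda>n. \<phi>\<^sub>2 (c n)) (pairing x y)"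
      "\<And>n. \<exists>p q. 0 < q \<and> q \<cdot>\<^bsub>S\<^sub>2\<^esub> c n \<preceq>\<^bsub>S\<^sub>2\<^esub> p \<cdot>\<^bsub>S\<^sub>2\<^esub> \<phi>\<^sub>1 x \<and>
         (ennreal (real p / real q) < jiang_su_value y \<or>
          y \<in> range Compact \<and> ennreal (real p / real q) = jiang_su_value y)"
      using pairing_seq[OF x y(1)] by blast
    obtain d where d: "\<And>n. d n \<in> carrier S\<^sub>2" "increasing_seq T (\<lambda>n. \<phi>\<^sub>2 (d n))"
      "is_seq_sup T (\<lambda>n. \<phi>\<^sub>2 (d n)) (pairing x y')"
      "\<And>n. \<exists>p q. 0 < q \<and> q \<cdot>\<^bsub>S\<^sub>2\<^esub> d n \<preceq>\<^bsub>S\<^sub>2\<^esub> p \<cdot>\<^bsub>S\<^sub>2\<^esub> \<phi>\<^sub>1 x \<and>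
         (ennreal (real p / real q) < jiang_su_value y' \<or>
          y' \<in> range Compact \<and> ennreal (real p / real q) = jiang_su_value y')"
      using pairing_seq[OF x y(2)] by blast
    have "\<phi>\<^sub>2 (c n) \<oplus>\<^bsub>T\<^esub> \<phi>\<^sub>2 (d n) \<preceq>\<^bsub>T\<^esub> pairing x (Soft t)" for n
    proof -
      obtain p q where pq: "0 < q" "q \<cdot>\<^bsub>S\<^sub>2\<^esub> c n \<preceq>\<^bsub>S\<^sub>2\<^esub> p \<cdot>\<^bsub>S\<^sub>2\<^esub> \<phi>\<^sub>1 x"
        "ennreal (real p / real q) < jiang_su_value y \<or>
          y \<in> range Compact \<and> ennreal (real p / real q) = jiang_su_value y"
        using c(4)[of n] by blast
      obtain p' q' where pq': "0 < q'" "q' \<cdot>\<^bsub>S\<^sub>2\<^esub> d n \<preceq>\<^bsub>S\<^sub>2\<^esub> p' \<cdot>\<^bsub>S\<^sub>2\<^esub> \<phi>\<^sub>1 x"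
        "ennreal (real p' / real q') < jiang_su_value y' \<or>
          y' \<in> range Compact \<and> ennreal (real p' / real q') = jiang_su_value y'"
        using d(4)[of n] by blast
      have soft: "y \<notin> range Compact \<or> y' \<notin> range Compact" using sum by auto
      have "ennreal (real p / real q) + ennreal (real p' / real q') < t"
        unfolding t by (rule ennreal_add_less) (use pq(3) pq'(3) soft in auto)
      then have "c n \<oplus>\<^bsub>S\<^sub>2\<^esub> d n \<in> fraction_below x t"
        using c(1) d(1) pq pq' x by (intro fraction_below_add) auto
      then have "\<phi>\<^sub>2 (c n \<oplus>\<^bsub>S\<^sub>2\<^esub> d n) \<preceq>\<^bsub>T\<^esub> pairing x (Soft t)"
        using pairing_upper[OF x carr] by simp
      then show ?thesis using c(1) d(1) by (simp add: \<phi>\<^sub>2_add)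
    qed
    then show "pairing x y \<oplus>\<^bsub>T\<^esub> pairing x y' \<preceq>\<^bsub>T\<^esub> pairing x (Soft t)"
      by (rule T.is_seq_sup_least[OF T.O4[OF c(2) d(2) c(3) d(3)] pairing_closed[OF x carr]])
  qed
  show ?thesis
  proof (cases "y = Compact 0 \<or> y' = Compact 0")
    case True
    then show ?thesis
      using pairing_closed[OF x y(1)] pairing_closed[OF x y(2)] by (cases y; cases y') auto
  next
    case False
    then show ?thesis
      using eq x by (cases y; cases y') (auto simp: T.nat_pow_mult)
  qed
qed

lemma gen_cu_morphism_pairing_right:
  assumes x: "x \<in> carrier S\<^sub>1"
  shows "gen_cu_morphism Cu_jiang_su T (pairing x)"
proof (rule gen_cu_morphismI)
  fix z s u
  assume z: "increasing_seq Cu_jiang_su z" "is_seq_sup Cu_jiang_su z s"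
    and u: "u \<in> carrier T" "\<And>n. pairing x (z n) \<preceq>\<^bsub>T\<^esub> u"
  have zc: "z n \<in> carrier Cu_jiang_su" for n using z(1) by (auto simp: increasing_seq_def)
  have sc: "s \<in> carrier Cu_jiang_su" using z(2) by (simp add: is_seq_sup_def)
  show "pairing x s \<preceq>\<^bsub>T\<^esub> u"
  proof (cases s)
    case (Compact n)
    then obtain j where "z j = Compact n" using Cu_jiang_su_sup_Compact z by blast
    then show ?thesis using u(2)[of j] Compact by simp
  next
    case (Soft t)
    then have t: "t \<noteq> 0" using sc by simp
    have "\<phi>\<^sub>2 a \<preceq>\<^bsub>T\<^esub> u" if a: "a \<in> fraction_below x t" for a
    proof -
      obtain p q where pq: "a \<in> carrier S\<^sub>2" "0 < q" "ennreal (real p / real q) < t"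
        "q \<cdot>\<^bsub>S\<^sub>2\<^esub> a \<preceq>\<^bsub>S\<^sub>2\<^esub> p \<cdot>\<^bsub>S\<^sub>2\<^esub> \<phi>\<^sub>1 x"
        using a by (rule fraction_belowE)
      obtain j where "ennreal (real p / real q) < jiang_su_value (z j)"
        using Cu_jiang_su_sup_Soft[OF _ pq(3)] z(2) Soft by blast
      then have "\<phi>\<^sub>2 a \<preceq>\<^bsub>T\<^esub> pairing x (z j)"
        using pq by (intro pairing_upper[OF x zc] fraction_belowI)
      then show ?thesis
        by (rule T.leq_transD) (use u x zc pq(1) in auto)
    qed
    then show ?thesis using soft_multiple_least[OF x t u(1)] Soft by simp
  qed
qed (use x pairing_mono_right pairing_add_right in auto)

lemma soft_multiple_sup:
  assumes z: "increasing_seq S\<^sub>1 z" "is_seq_sup S\<^sub>1 z s" and t: "t \<noteq> 0"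
    and u: "u \<in> carrier T" "\<And>n. soft_multiple (z n) t \<preceq>\<^bsub>T\<^esub> u"
  shows "soft_multiple s t \<preceq>\<^bsub>T\<^esub> u"
proof (rule soft_multiple_least[OF S\<^sub>1.is_seq_sup_carrier[OF z(2)] t u(1)])
  fix a assume "a \<in> fraction_below s t"
  then obtain p q where pq: "a \<in> carrier S\<^sub>2" "0 < q" "ennreal (real p / real q) < t"
    "q \<cdot>\<^bsub>S\<^sub>2\<^esub> a \<preceq>\<^bsub>S\<^sub>2\<^esub> p \<cdot>\<^bsub>S\<^sub>2\<^esub> \<phi>\<^sub>1 s"
    by (rule fraction_belowE)
  show "\<phi>\<^sub>2 a \<preceq>\<^bsub>T\<^esub> u"
  proof (rule \<phi>\<^sub>2_leq_by_approximation[OF z pq(1,4) u(1)])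
    fix b j assume b: "b \<in> carrier S\<^sub>2" "q \<cdot>\<^bsub>S\<^sub>2\<^esub> b \<preceq>\<^bsub>S\<^sub>2\<^esub> p \<cdot>\<^bsub>S\<^sub>2\<^esub> \<phi>\<^sub>1 (z j)"
    have zj: "z j \<in> carrier S\<^sub>1" using z(1) by simp
    have "\<phi>\<^sub>2 b \<preceq>\<^bsub>T\<^esub> soft_multiple (z j) t"
      using b pq by (intro soft_multiple_upper[OF zj t] fraction_belowI)
    then show "\<phi>\<^sub>2 b \<preceq>\<^bsub>T\<^esub> u"
      by (rule T.leq_transD[OF _ u(2)]) (use b u(1) soft_multiple_closed[OF zj t] in auto)
  qed
qed

lemma soft_multiple_add:
  assumes x: "x \<in> carrier S\<^sub>1" and y: "y \<in> carrier S\<^sub>1" and t: "t \<noteq> 0"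
  shows "soft_multiple (x \<oplus>\<^bsub>S\<^sub>1\<^esub> y) t = soft_multiple x t \<oplus>\<^bsub>T\<^esub> soft_multiple y t"
proof (rule T.leq_antisymD)
  have xy: "x \<oplus>\<^bsub>S\<^sub>1\<^esub> y \<in> carrier S\<^sub>1" using x y by simp
  note closed = soft_multiple_closed[OF x t] soft_multiple_closed[OF y t] soft_multiple_closed[OF xy t]
  show "soft_multiple (x \<oplus>\<^bsub>S\<^sub>1\<^esub> y) t \<in> carrier T"
    "soft_multiple x t \<oplus>\<^bsub>T\<^esub> soft_multiple y t \<in> carrier T"
    using closed by auto
  obtain c where c: "\<And>n. c n \<in> fraction_below x t" "increasing_seq T (\<lambda>n. \<phi>\<^sub>2 (c n))"
    "is_seq_sup T (\<lambda>n. \<phi>\<^sub>2 (c n)) (soft_multiple x t)"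
    using soft_multiple_seq[OF x t] by blast
  obtain d where d: "\<And>n. d n \<in> fraction_below y t" "increasing_seq T (\<lambda>n. \<phi>\<^sub>2 (d n))"
    "is_seq_sup T (\<lambda>n. \<phi>\<^sub>2 (d n)) (soft_multiple y t)"
    using soft_multiple_seq[OF y t] by blast
  have "\<phi>\<^sub>2 (c n) \<oplus>\<^bsub>T\<^esub> \<phi>\<^sub>2 (d n) \<preceq>\<^bsub>T\<^esub> soft_multiple (x \<oplus>\<^bsub>S\<^sub>1\<^esub> y) t" for n
  proof -
    obtain p q where pq: "c n \<in> carrier S\<^sub>2" "0 < q" "ennreal (real p / real q) < t"
      "q \<cdot>\<^bsub>S\<^sub>2\<^esub> c n \<preceq>\<^bsub>S\<^sub>2\<^esub> p \<cdot>\<^bsub>S\<^sub>2\<^esub> \<phi>\<^sub>1 x"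
      using c(1) by (rule fraction_belowE)
    obtain p' q' where pq': "d n \<in> carrier S\<^sub>2" "0 < q'" "ennreal (real p' / real q') < t"
      "q' \<cdot>\<^bsub>S\<^sub>2\<^esub> d n \<preceq>\<^bsub>S\<^sub>2\<^esub> p' \<cdot>\<^bsub>S\<^sub>2\<^esub> \<phi>\<^sub>1 y"
      using d(1) by (rule fraction_belowE)
    \<comment> \<open>The larger of the fractions \<open>p/q\<close> and \<open>p'/q'\<close> is \<open>l/(q q')\<close>.\<close>
    define l where "l = max (p * q') (p' * q)"
    have common: "(q * q') \<cdot>\<^bsub>S\<^sub>2\<^esub> e \<preceq>\<^bsub>S\<^sub>2\<^esub> l \<cdot>\<^bsub>S\<^sub>2\<^esub> \<phi>\<^sub>1 w"
      if "e \<in> carrier S\<^sub>2" "w \<in> carrier S\<^sub>1" "j \<cdot>\<^bsub>S\<^sub>2\<^esub> e \<preceq>\<^bsub>S\<^sub>2\<^esub> i \<cdot>\<^bsub>S\<^sub>2\<^esub> \<phi>\<^sub>1 w" "j * j' = q * q'" "i * j' \<le> l"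
      for e w i j j'
    proof -
      have "(j * j') \<cdot>\<^bsub>S\<^sub>2\<^esub> e \<preceq>\<^bsub>S\<^sub>2\<^esub> (i * j') \<cdot>\<^bsub>S\<^sub>2\<^esub> \<phi>\<^sub>1 w"
        using S\<^sub>2.multiple_mono[OF that(3), of j'] that(1,2) by (simp add: S\<^sub>2.nat_pow_pow)
      then show ?thesis
        unfolding that(4)
        by (rule S\<^sub>2.leq_transD) (use that in \<open>auto intro: S\<^sub>2.multiple_mono_nat\<close>)
    qed
    have "(q * q') \<cdot>\<^bsub>S\<^sub>2\<^esub> c n \<oplus>\<^bsub>S\<^sub>2\<^esub> (q * q') \<cdot>\<^bsub>S\<^sub>2\<^esub> d n \<preceq>\<^bsub>S\<^sub>2\<^esub> l \<cdot>\<^bsub>S\<^sub>2\<^esub> \<phi>\<^sub>1 x \<oplus>\<^bsub>S\<^sub>2\<^esub> l \<cdot>\<^bsub>S\<^sub>2\<^esub> \<phi>\<^sub>1 y"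
      using common[OF pq(1) x pq(4), of q'] common[OF pq'(1) y pq'(4), of q] pq(1) pq'(1) x y
      by (intro S\<^sub>2.add_mono) (auto simp: l_def mult.commute)
    then have "(q * q') \<cdot>\<^bsub>S\<^sub>2\<^esub> (c n \<oplus>\<^bsub>S\<^sub>2\<^esub> d n) \<preceq>\<^bsub>S\<^sub>2\<^esub> l \<cdot>\<^bsub>S\<^sub>2\<^esub> \<phi>\<^sub>1 (x \<oplus>\<^bsub>S\<^sub>1\<^esub> y)"
      using pq(1) pq'(1) x y by (simp add: \<phi>\<^sub>1_add S\<^sub>2.multiple_add)
    moreover have "ennreal (real l / real (q * q')) < t"
    proof -
      have "real l / real (q * q') = max (real p / real q) (real p' / real q')"
        using pq(2) pq'(2) by (auto simp: l_def max_def field_simps simp flip: of_nat_mult)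
      then show ?thesis using pq(3) pq'(3) by (auto simp: max_def)
    qed
    ultimately have "c n \<oplus>\<^bsub>S\<^sub>2\<^esub> d n \<in> fraction_below (x \<oplus>\<^bsub>S\<^sub>1\<^esub> y) t"
      using pq(1,2) pq'(1,2) by (intro fraction_belowI) auto
    then have "\<phi>\<^sub>2 (c n \<oplus>\<^bsub>S\<^sub>2\<^esub> d n) \<preceq>\<^bsub>T\<^esub> soft_multiple (x \<oplus>\<^bsub>S\<^sub>1\<^esub> y) t"
      by (rule soft_multiple_upper[OF xy t])
    then show ?thesis using pq(1) pq'(1) by (simp add: \<phi>\<^sub>2_add)
  qed
  then show "soft_multiple x t \<oplus>\<^bsub>T\<^esub> soft_multiple y t \<preceq>\<^bsub>T\<^esub> soft_multiple (x \<oplus>\<^bsub>S\<^sub>1\<^esub> y) t"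
    by (rule T.is_seq_sup_least[OF T.O4[OF c(2) d(2) c(3) d(3)] closed(3)])
  show "soft_multiple (x \<oplus>\<^bsub>S\<^sub>1\<^esub> y) t \<preceq>\<^bsub>T\<^esub> soft_multiple x t \<oplus>\<^bsub>T\<^esub> soft_multiple y t"
  proof (rule soft_multiple_least[OF xy t])
    fix a assume "a \<in> fraction_below (x \<oplus>\<^bsub>S\<^sub>1\<^esub> y) t"
    then obtain p q where pq: "a \<in> carrier S\<^sub>2" "0 < q" "ennreal (real p / real q) < t"
      "q \<cdot>\<^bsub>S\<^sub>2\<^esub> a \<preceq>\<^bsub>S\<^sub>2\<^esub> p \<cdot>\<^bsub>S\<^sub>2\<^esub> \<phi>\<^sub>1 (x \<oplus>\<^bsub>S\<^sub>1\<^esub> y)"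
      by (rule fraction_belowE)
    obtain k m where m: "0 < k" "ennreal (real m / real k) < t"
      "real p / real q < real m / real (k + 1)"
      by (rule fraction_between[OF _ pq(3)]) simp_all
    obtain xs where xs: "increasing_seq S\<^sub>1 xs" "is_seq_sup S\<^sub>1 xs x"
      "\<And>n. way_below S\<^sub>1 (xs n) (xs (Suc n))" "\<And>n. way_below S\<^sub>1 (xs n) x"
      using S\<^sub>1.way_below_approximation[OF x] by blast
    obtain ys where ys: "increasing_seq S\<^sub>1 ys" "is_seq_sup S\<^sub>1 ys y"
      "\<And>n. way_below S\<^sub>1 (ys n) (ys (Suc n))" "\<And>n. way_below S\<^sub>1 (ys n) y"
      using S\<^sub>1.way_below_approximation[OF y] by blast
    have inc: "increasing_seq S\<^sub>1 (\<lambda>n. xs n \<oplus>\<^bsub>S\<^sub>1\<^esub> ys n)"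
      using xs(1) ys(1) by (rule S\<^sub>1.increasing_seq_add)
    show "\<phi>\<^sub>2 a \<preceq>\<^bsub>T\<^esub> soft_multiple x t \<oplus>\<^bsub>T\<^esub> soft_multiple y t"
    proof (rule \<phi>\<^sub>2_leq_by_approximation[OF inc S\<^sub>1.O4[OF xs(1) ys(1) xs(2) ys(2)] pq(1,4)])
      fix b j assume b: "b \<in> carrier S\<^sub>2" "q \<cdot>\<^bsub>S\<^sub>2\<^esub> b \<preceq>\<^bsub>S\<^sub>2\<^esub> p \<cdot>\<^bsub>S\<^sub>2\<^esub> \<phi>\<^sub>1 (xs j \<oplus>\<^bsub>S\<^sub>1\<^esub> ys j)"
      obtain z where z: "z \<in> carrier S\<^sub>2" "k \<cdot>\<^bsub>S\<^sub>2\<^esub> z \<preceq>\<^bsub>S\<^sub>2\<^esub> \<phi>\<^sub>1 x"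
        "\<phi>\<^sub>1 (xs j) \<preceq>\<^bsub>S\<^sub>2\<^esub> (k + 1) \<cdot>\<^bsub>S\<^sub>2\<^esub> z"
        by (rule almost_part[OF xs(4)])
      obtain w where w: "w \<in> carrier S\<^sub>2" "k \<cdot>\<^bsub>S\<^sub>2\<^esub> w \<preceq>\<^bsub>S\<^sub>2\<^esub> \<phi>\<^sub>1 y"
        "\<phi>\<^sub>1 (ys j) \<preceq>\<^bsub>S\<^sub>2\<^esub> (k + 1) \<cdot>\<^bsub>S\<^sub>2\<^esub> w"
        by (rule almost_part[OF ys(4)])
      have carr: "xs j \<in> carrier S\<^sub>1" "ys j \<in> carrier S\<^sub>1" using xs(1) ys(1) by simp_all
      have "\<phi>\<^sub>1 (xs j \<oplus>\<^bsub>S\<^sub>1\<^esub> ys j) \<preceq>\<^bsub>S\<^sub>2\<^esub> (k + 1) \<cdot>\<^bsub>S\<^sub>2\<^esub> (z \<oplus>\<^bsub>S\<^sub>2\<^esub> w)"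
        unfolding S\<^sub>2.multiple_add[OF z(1) w(1)] \<phi>\<^sub>1_add[OF carr]
        using z w carr by (intro S\<^sub>2.add_mono) auto
      then have "\<phi>\<^sub>2 b \<preceq>\<^bsub>T\<^esub> \<phi>\<^sub>2 (m \<cdot>\<^bsub>S\<^sub>2\<^esub> (z \<oplus>\<^bsub>S\<^sub>2\<^esub> w))"
        using b z(1) w(1) carr by (intro \<phi>\<^sub>2_leq_multipleI[OF pq(2) b(2) _ m(3)]) auto
      also have "\<phi>\<^sub>2 (m \<cdot>\<^bsub>S\<^sub>2\<^esub> (z \<oplus>\<^bsub>S\<^sub>2\<^esub> w)) = \<phi>\<^sub>2 (m \<cdot>\<^bsub>S\<^sub>2\<^esub> z) \<oplus>\<^bsub>T\<^esub> \<phi>\<^sub>2 (m \<cdot>\<^bsub>S\<^sub>2\<^esub> w)"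
        using z(1) w(1) by (simp add: \<phi>\<^sub>2_add S\<^sub>2.multiple_add)
      finally have "\<phi>\<^sub>2 b \<preceq>\<^bsub>T\<^esub> \<phi>\<^sub>2 (m \<cdot>\<^bsub>S\<^sub>2\<^esub> z) \<oplus>\<^bsub>T\<^esub> \<phi>\<^sub>2 (m \<cdot>\<^bsub>S\<^sub>2\<^esub> w)" .
      moreover have "\<phi>\<^sub>2 (m \<cdot>\<^bsub>S\<^sub>2\<^esub> z) \<oplus>\<^bsub>T\<^esub> \<phi>\<^sub>2 (m \<cdot>\<^bsub>S\<^sub>2\<^esub> w) \<preceq>\<^bsub>T\<^esub> soft_multiple x t \<oplus>\<^bsub>T\<^esub> soft_multiple y t"
        using x y z w t m(1,2) closed
        by (intro T.add_mono soft_multiple_upper multiple_of_part_mem) auto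
      ultimately show "\<phi>\<^sub>2 b \<preceq>\<^bsub>T\<^esub> soft_multiple x t \<oplus>\<^bsub>T\<^esub> soft_multiple y t"
        by (rule T.leq_transD) (use b(1) z(1) w(1) closed in auto)
    qed (use closed in auto)
  qed (use closed in auto)
qed

lemma gen_cu_morphism_pairing_left:
  assumes y: "y \<in> carrier Cu_jiang_su"
  shows "gen_cu_morphism S\<^sub>1 T (\<lambda>x. pairing x y)"
proof (cases y)
  case (Compact n)
  show ?thesis
    unfolding Compact pairing.simps
  proof (rule gen_cu_morphismI)
    fix z s u
    assume z: "increasing_seq S\<^sub>1 z" "is_seq_sup S\<^sub>1 z s"
      and u: "u \<in> carrier T" "\<And>j. n \<cdot>\<^bsub>T\<^esub> \<phi>\<^sub>2 (\<phi>\<^sub>1 (z j)) \<preceq>\<^bsub>T\<^esub> u"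
    have "increasing_seq T (\<lambda>j. \<phi>\<^sub>2 (\<phi>\<^sub>1 (z j)))" "is_seq_sup T (\<lambda>j. \<phi>\<^sub>2 (\<phi>\<^sub>1 (z j))) (\<phi>\<^sub>2 (\<phi>\<^sub>1 s))"
      using z gen_cu_morphismD(5,6)[OF gen\<^sub>1] gen_cu_morphismD(5,6)[OF gen\<^sub>2] by blast+
    from T.is_seq_sup_least[OF T.is_seq_sup_multiple[OF this] u]
    show "n \<cdot>\<^bsub>T\<^esub> \<phi>\<^sub>2 (\<phi>\<^sub>1 s) \<preceq>\<^bsub>T\<^esub> u" .
  qed (auto simp: \<phi>\<^sub>1_add \<phi>\<^sub>2_add T.multiple_add intro!: T.multiple_mono \<phi>\<^sub>1_mono \<phi>\<^sub>2_mono)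
next
  case (Soft t)
  then have t: "t \<noteq> 0" using y by simp
  show ?thesis
    unfolding Soft pairing.simps
  proof (rule gen_cu_morphismI)
    have "\<phi>\<^sub>2 a \<preceq>\<^bsub>T\<^esub> \<zero>\<^bsub>T\<^esub>" if a: "a \<in> fraction_below \<zero>\<^bsub>S\<^sub>1\<^esub> t" for a
    proof -
      obtain p q where pq: "a \<in> carrier S\<^sub>2" "0 < q" "ennreal (real p / real q) < t"
        "q \<cdot>\<^bsub>S\<^sub>2\<^esub> a \<preceq>\<^bsub>S\<^sub>2\<^esub> p \<cdot>\<^bsub>S\<^sub>2\<^esub> \<phi>\<^sub>1 \<zero>\<^bsub>S\<^sub>1\<^esub>"
        using a by (rule fraction_belowE)
      have "1 \<cdot>\<^bsub>S\<^sub>2\<^esub> a \<preceq>\<^bsub>S\<^sub>2\<^esub> q \<cdot>\<^bsub>S\<^sub>2\<^esub> a" using pq(1,2) by (intro S\<^sub>2.multiple_mono_nat) auto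
      then have "a \<preceq>\<^bsub>S\<^sub>2\<^esub> \<zero>\<^bsub>S\<^sub>2\<^esub>"
        using S\<^sub>2.leq_transD[OF _ pq(4)] pq(1) by simp
      then show ?thesis using \<phi>\<^sub>2_mono[OF pq(1), of "\<zero>\<^bsub>S\<^sub>2\<^esub>"] by simp
    qed
    then show "soft_multiple \<zero>\<^bsub>S\<^sub>1\<^esub> t = \<zero>\<^bsub>T\<^esub>"
      using t by (intro T.leq_antisymD soft_multiple_least T.zero_least soft_multiple_closed) auto
  next
    fix x x' assume x: "x \<in> carrier S\<^sub>1" "x' \<in> carrier S\<^sub>1" "x \<preceq>\<^bsub>S\<^sub>1\<^esub> x'"
    show "soft_multiple x t \<preceq>\<^bsub>T\<^esub> soft_multiple x' t"
      using fraction_below_mono[OF x(3,1,2) order_refl, of t] soft_multiple_closed[OF x(2) t]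
      by (intro soft_multiple_least[OF x(1) t] soft_multiple_upper[OF x(2) t]) auto
  qed (use t soft_multiple_closed soft_multiple_add soft_multiple_sup in auto)
qed

lemma gen_cu_bimorphism_pairing: "gen_cu_bimorphism S\<^sub>1 Cu_jiang_su T pairing"
  using gen_cu_morphism_pairing_left gen_cu_morphism_pairing_right
  by (auto simp: gen_cu_bimorphism_def)

text \<open>If both morphisms preserve \<open>\<lless>\<close>, then so does the pairing at soft elements.\<close>

lemma pairing_way_below_Soft:
  assumes way\<^sub>1: "\<And>x y. way_below S\<^sub>1 x y \<Longrightarrow> way_below S\<^sub>2 (\<phi>\<^sub>1 x) (\<phi>\<^sub>1 y)"
    and way\<^sub>2: "\<And>x y. way_below S\<^sub>2 x y \<Longrightarrow> way_below T (\<phi>\<^sub>2 x) (\<phi>\<^sub>2 y)"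
    and x: "way_below S\<^sub>1 x' x" and r: "0 < r" "ennreal r < t"
  shows "way_below T (soft_multiple x' (ennreal r)) (soft_multiple x t)"
proof -
  note carr = S\<^sub>1.way_below_carrier[OF x]
  have t: "t \<noteq> 0" and r0: "ennreal r \<noteq> 0" using r by auto
  obtain x'' where x'': "way_below S\<^sub>1 x' x''" "way_below S\<^sub>1 x'' x"
    by (rule S\<^sub>1.way_below_interpolation[OF x])
  obtain k m where m: "0 < k" "ennreal (real m / real k) < t" "r < real m / real (k + 1)"
    by (rule fraction_between[OF less_imp_le[OF r(1)] r(2)])
  obtain z where z: "z \<in> carrier S\<^sub>2" "k \<cdot>\<^bsub>S\<^sub>2\<^esub> z \<preceq>\<^bsub>S\<^sub>2\<^esub> \<phi>\<^sub>1 x" "\<phi>\<^sub>1 x'' \<preceq>\<^bsub>S\<^sub>2\<^esub> (k + 1) \<cdot>\<^bsub>S\<^sub>2\<^esub> z"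
    by (rule almost_part[OF x''(2)])
  obtain zs where zs: "increasing_seq S\<^sub>2 zs" "is_seq_sup S\<^sub>2 zs z"
    "\<And>n. way_below S\<^sub>2 (zs n) (zs (Suc n))" "\<And>n. way_below S\<^sub>2 (zs n) z"
    using S\<^sub>2.way_below_approximation[OF z(1)] by blast
  \<comment> \<open>\<open>\<phi>\<^sub>1 x' \<lless> \<phi>\<^sub>1 x''\<close> leaves room to replace \<open>z\<close> by a member of the sequence approximating it.\<close>
  obtain j where j: "\<phi>\<^sub>1 x' \<preceq>\<^bsub>S\<^sub>2\<^esub> (k + 1) \<cdot>\<^bsub>S\<^sub>2\<^esub> zs j"
    using S\<^sub>2.way_belowD[OF way\<^sub>1[OF x''(1)] S\<^sub>2.increasing_seq_multiple[OF zs(1)]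
        S\<^sub>2.is_seq_sup_multiple[OF zs(1,2)] z(3)] by blast
  have zj: "zs j \<in> carrier S\<^sub>2" using zs(1) by simp
  have "soft_multiple x' (ennreal r) \<preceq>\<^bsub>T\<^esub> \<phi>\<^sub>2 (m \<cdot>\<^bsub>S\<^sub>2\<^esub> zs j)"
  proof (rule soft_multiple_least[OF carr(1) r0])
    fix a assume "a \<in> fraction_below x' (ennreal r)"
    then obtain p q where pq: "a \<in> carrier S\<^sub>2" "0 < q" "ennreal (real p / real q) < ennreal r"
      "q \<cdot>\<^bsub>S\<^sub>2\<^esub> a \<preceq>\<^bsub>S\<^sub>2\<^esub> p \<cdot>\<^bsub>S\<^sub>2\<^esub> \<phi>\<^sub>1 x'"
      by (rule fraction_belowE)
    have "real p / real q < real m / real (k + 1)"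
      using pq(3) m(3) by (simp add: ennreal_less_iff)
    then show "\<phi>\<^sub>2 a \<preceq>\<^bsub>T\<^esub> \<phi>\<^sub>2 (m \<cdot>\<^bsub>S\<^sub>2\<^esub> zs j)"
      using \<phi>\<^sub>2_leq_multipleI[OF pq(2,4) j _ pq(1) _ zj] carr by simp
  qed (use zj in simp)
  moreover have "way_below T (\<phi>\<^sub>2 (m \<cdot>\<^bsub>S\<^sub>2\<^esub> zs j)) (\<phi>\<^sub>2 (m \<cdot>\<^bsub>S\<^sub>2\<^esub> z))"
    by (intro way\<^sub>2 S\<^sub>2.way_below_multiple zs(4))
  moreover have "\<phi>\<^sub>2 (m \<cdot>\<^bsub>S\<^sub>2\<^esub> z) \<preceq>\<^bsub>T\<^esub> soft_multiple x t"
    using z m(1,2) carr by (intro soft_multiple_upper[OF carr(2) t] multiple_of_part_mem) auto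
  ultimately show ?thesis
    by (rule T.way_below_mono) (use soft_multiple_closed carr r0 t in auto)
qed

lemma cu_bimorphism_pairing:
  assumes way\<^sub>1: "\<And>x y. way_below S\<^sub>1 x y \<Longrightarrow> way_below S\<^sub>2 (\<phi>\<^sub>1 x) (\<phi>\<^sub>1 y)"
    and way\<^sub>2: "\<And>x y. way_below S\<^sub>2 x y \<Longrightarrow> way_below T (\<phi>\<^sub>2 x) (\<phi>\<^sub>2 y)"
  shows "cu_bimorphism S\<^sub>1 Cu_jiang_su T pairing"
proof -
  have "way_below T (pairing x' y') (pairing x y)"
    if x: "way_below S\<^sub>1 x' x" and y: "way_below Cu_jiang_su y' y" for x' x y' y
  proof -
    note xc = S\<^sub>1.way_below_carrier[OF x]
    have yc: "y' \<in> carrier Cu_jiang_su" "y \<in> carrier Cu_jiang_su"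
      using y by (auto simp: way_below_def)
    \<comment> \<open>For compact \<open>y\<close> take \<open>w = y\<close>, for soft \<open>y\<close> a smaller soft element.\<close>
    have "\<exists>w. w \<in> carrier Cu_jiang_su \<and> jiang_su_leq y' w \<and>
        way_below T (pairing x' w) (pairing x y)"
    proof (cases y)
      case (Compact n)
      have "increasing_seq Cu_jiang_su (\<lambda>_. Compact n)" "is_seq_sup Cu_jiang_su (\<lambda>_. Compact n) (Compact n)"
        by (auto simp: increasing_seq_def monotone_on_def is_seq_sup_def)
      then have "jiang_su_leq y' y"
        using y Compact unfolding way_below_def by fastforce
      moreover have "way_below T (pairing x' y) (pairing x y)"
        using x by (simp add: Compact T.way_below_multiple way\<^sub>1 way\<^sub>2)
      ultimately show ?thesis using yc by blast
    next
      case (Soft t)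
      then obtain r where r: "0 < r" "ennreal r < t" "jiang_su_leq y' (Soft (ennreal r))"
        using Cu_jiang_su_way_below_Soft y by blast
      then have "way_below T (pairing x' (Soft (ennreal r))) (pairing x y)"
        using pairing_way_below_Soft[OF way\<^sub>1 way\<^sub>2 x] Soft by simp
      then show ?thesis using r by (intro exI[of _ "Soft (ennreal r)"]) simp
    qed
    then obtain w where w: "w \<in> carrier Cu_jiang_su" "jiang_su_leq y' w"
      "way_below T (pairing x' w) (pairing x y)" by blast
    show ?thesis
      by (rule T.way_below_mono[OF pairing_mono_right w(3)]) (use xc yc w in auto)
  qed
  then show ?thesis using gen_cu_bimorphism_pairing by (auto simp: cu_bimorphism_def)
qed

end

section \<open>Factorization through the tensor product\<close>

theorem theorem5p5:
  fixes S\<^sub>1 :: "'a pomonoid" and S\<^sub>2 :: "'b pomonoid" and T :: "'t pomonoid"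
    and P :: "'p pomonoid" and tensor :: "'a \<Rightarrow> jiang_su \<Rightarrow> 'p"
    and \<phi>\<^sub>1 :: "'a \<Rightarrow> 'b" and \<phi>\<^sub>2 :: "'b \<Rightarrow> 't"
  assumes "cu_semigroup S\<^sub>1" and "cu_semigroup S\<^sub>2" and "cu_semigroup T"
    and "is_cu_tensor TYPE('t) S\<^sub>1 Cu_jiang_su P tensor"
    and "gen_cu_morphism S\<^sub>1 S\<^sub>2 \<phi>\<^sub>1" and "gen_cu_morphism S\<^sub>2 T \<phi>\<^sub>2"
    and "almost_divisible S\<^sub>1 S\<^sub>2 \<phi>\<^sub>1" and "almost_unperforated S\<^sub>2 T \<phi>\<^sub>2"
  shows "(\<exists>\<beta>. gen_cu_morphism P T \<beta> \<and>
            (\<forall>x\<in>carrier S\<^sub>1. \<beta> (tensor x (Compact 1)) = \<phi>\<^sub>2 (\<phi>\<^sub>1 x))) \<and>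
         (cu_morphism S\<^sub>1 S\<^sub>2 \<phi>\<^sub>1 \<and> cu_morphism S\<^sub>2 T \<phi>\<^sub>2 \<longrightarrow>
           (\<exists>\<beta>. cu_morphism P T \<beta> \<and>
             (\<forall>x\<in>carrier S\<^sub>1. \<beta> (tensor x (Compact 1)) = \<phi>\<^sub>2 (\<phi>\<^sub>1 x))))"
proof -
  interpret divisible_unperforated_pair S\<^sub>1 S\<^sub>2 T \<phi>\<^sub>1 \<phi>\<^sub>2
    using assms by (simp add: divisible_unperforated_pair_def divisible_unperforated_pair_axioms_def)
  have at_one: "\<beta> (tensor x (Compact 1)) = \<phi>\<^sub>2 (\<phi>\<^sub>1 x)"
    if "\<forall>x\<in>carrier S\<^sub>1. \<forall>y\<in>carrier Cu_jiang_su. \<beta> (tensor x y) = pairing x y" and "x \<in> carrier S\<^sub>1"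
    for \<beta> x
    using that by simp
  show ?thesis
  proof (intro conjI impI)
    obtain \<beta> where "gen_cu_morphism P T \<beta>"
      "\<forall>x\<in>carrier S\<^sub>1. \<forall>y\<in>carrier Cu_jiang_su. \<beta> (tensor x y) = pairing x y"
      using assms(3,4) gen_cu_bimorphism_pairing unfolding is_cu_tensor_def by blast
    then show "\<exists>\<beta>. gen_cu_morphism P T \<beta> \<and>
        (\<forall>x\<in>carrier S\<^sub>1. \<beta> (tensor x (Compact 1)) = \<phi>\<^sub>2 (\<phi>\<^sub>1 x))"
      using at_one by blast
  next
    assume "cu_morphism S\<^sub>1 S\<^sub>2 \<phi>\<^sub>1 \<and> cu_morphism S\<^sub>2 T \<phi>\<^sub>2"
    then have "cu_bimorphism S\<^sub>1 Cu_jiang_su T pairing"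
      by (intro cu_bimorphism_pairing) (auto simp: cu_morphism_def)
    then obtain \<beta> where "cu_morphism P T \<beta>"
      "\<forall>x\<in>carrier S\<^sub>1. \<forall>y\<in>carrier Cu_jiang_su. \<beta> (tensor x y) = pairing x y"
      using assms(3,4) unfolding is_cu_tensor_def by blast
    then show "\<exists>\<beta>. cu_morphism P T \<beta> \<and>
        (\<forall>x\<in>carrier S\<^sub>1. \<beta> (tensor x (Compact 1)) = \<phi>\<^sub>2 (\<phi>\<^sub>1 x))"
      using at_one by blast
  qed
qed

end
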